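(* Let $L$ be an inertia operator on $\mathrm{Imm}(S^1,\mathbb R^3)$ that is equivariant under the $\mathrm{Diff}^+(S^1)$-action and maps vertical tangent vectors to $\mathrm{span}\{c,c_\theta\}$, i.e., for all $c\in \mathrm{Imm}(S^1,\mathbb R^3)$ and $a\in C^{\infty}(S^1)$ we have $L_c(a\,c_\theta)=a_1 c_\theta+a_2 c$ for some functions $a_1,a_2\in C^{\infty}(S^1)$. Then the 2-form $\Omega^L=-d\Theta^L$, where $\Theta^L_c(h)=\int_{S^1}\langle c\times D_sc,L_ch\rangle ds$, factors to a (pre)symplectic form $\bar\Omega^L$ on $B_i(S^1,\mathbb R^3)=\mathrm{Imm}(S^1,\mathbb R^3)/\mathrm{Diff}^+(S^1)$.
   Context: $\mathrm{Imm}(S^1,\mathbb R^3)=\{c\in C^\infty(S^1,\mathbb R^3): |c_\theta|\neq 0 \text{ everywhere}\}$ is an open subset of $C^\infty(S^1,\mathbb R^3)$, with tangent spaces $T_c\mathrm{Imm}(S^1,\mathbb R^3)=C^\infty(S^1,\mathbb R^3)$; $c_\theta=\partial_\theta c$. For an immersion $c$, $D_s=\frac1{|c_\theta|}\partial_\theta$ and $ds=|c_\theta|\,d\theta$; $\times$ is the cross product on $\mathbb R^3$. $\mathrm{Diff}^+(S^1)$ (orientation preserving diffeomorphisms) acts by composition from the right; $\pi:\mathrm{Imm}(S^1,\mathbb R^3)\to B_i(S^1,\mathbb R^3)$ is the quotient projection, and $B_i(S^1,\mathbb R^3)$ is an infinite dimensional orbifold. Vertical tangent vectors at $c$ are those tangent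 to the $\mathrm{Diff}^+(S^1)$-orbit, i.e. $h=a\,c_\theta$ with $a\in C^\infty(S^1)$. An inertia operator is a smooth section $L\in\Gamma(\mathrm{End}(T\mathrm{Imm}(S^1,\mathbb R^3)))$, i.e. a family of linear operators $L_c:C^\infty(S^1,\mathbb R^3)\to C^\infty(S^1,\mathbb R^3)$ depending smoothly on $c$, such that each $L_c$ is an elliptic pseudodifferential operator which is self-adjoint for the $L^2(ds)$ inner product, and such that $G^L_c(h,k)=\int_{S^1}\langle L_ch,k\rangle ds$ is a weak Riemannian metric; it is also assumed to be $SO(3)$-equivariant, $L_{Oc}(Oh)=O(L_ch)$. $\mathrm{Diff}^+(S^1)$-equivariance means $L_{c\circ\varphi}(h\circ\varphi)=(L_ch)\circ\varphi$. A form $\alpha$ on $\mathrm{Imm}(S^1,\mathbb R^3)$ factors to a form $\bar\alpha$ on $B_i(S^1,\mathbb R^3)$ if $\alpha=\pi^*\bar\alpha$; this holds if and only if $\alpha$ is $\mathrm{Diff}^+(S^1)$-invariant and horizontal (it vanishes when a vertical vector is inserted). A (pre)symplectic form is a closed 2-form (possibly degenerate). *)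

theory Defs
  imports "HOL-Analysis.Analysis"
begin

section \<open>Smooth functions on open subsets of \<open>\<real>\<^sup>n\<close>\<close>

text \<open>
  \<open>\<real>\<^sup>n\<close> for varying \<open>n\<close> is the library's \<open>Euclidean_space n\<close>: functions \<open>nat \<Rightarrow> real\<close> vanishing from
  index \<open>n\<close> on. \<open>Ck_on k n U f\<close> says that all iterated partial derivatives of \<open>f\<close> of order at most
  \<open>k\<close> exist and are continuous on \<open>U\<close>.
\<close>

primrec Ck_on :: "nat \<Rightarrow> nat \<Rightarrow> (nat \<Rightarrow> real) set \<Rightarrow> ((nat \<Rightarrow> real) \<Rightarrow> 'b::real_normed_vector) \<Rightarrow> bool"
  where
    "Ck_on 0 n U f \<longleftrightarrow> continuous_on U f"
  | "Ck_on (Suc k) n U f \<longleftrightarrow> continuous_on U f \<and>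
       (\<forall>i<n. \<exists>g. Ck_on k n U g \<and>
          (\<forall>x\<in>U. ((\<lambda>t. f (x(i := t))) has_vector_derivative g x) (at (x i))))"

definition smooth_on_Rn :: "nat \<Rightarrow> (nat \<Rightarrow> real) set \<Rightarrow> ((nat \<Rightarrow> real) \<Rightarrow> 'b::real_normed_vector) \<Rightarrow> bool"
  where "smooth_on_Rn n U f \<longleftrightarrow> openin (Euclidean_space n) U \<and> (\<forall>k. Ck_on k n U f)"

section \<open>Functions on the circle\<close>

text \<open>
  \<open>S\<^sup>1 = \<real> / 2\<pi>\<int>\<close>; functions on the circle are \<open>2\<pi>\<close>-periodic functions of a real variable.
\<close>

definition periodic :: "(real \<Rightarrow> 'b) \<Rightarrow> bool"
  where "periodic f \<longleftrightarrow> (\<forall>\<theta>. f (\<theta> + 2 * pi) = f \<theta>)"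

definition D\<theta> :: "(real \<Rightarrow> 'b::real_normed_vector) \<Rightarrow> real \<Rightarrow> 'b"
  where "D\<theta> f = (\<lambda>\<theta>. vector_derivative f (at \<theta>))"

definition smooth_real :: "(real \<Rightarrow> 'b::real_normed_vector) \<Rightarrow> bool"
  where "smooth_real f \<longleftrightarrow> (\<forall>k \<theta>. (D\<theta> ^^ k) f differentiable (at \<theta>))"

definition C_inf :: "(real \<Rightarrow> 'b::real_normed_vector) set"
  where "C_inf = {f. periodic f \<and> smooth_real f}"

type_synonym curve = "real \<Rightarrow> real^3"

definition Imm :: "curve set"
  where "Imm = {c \<in> C_inf. \<forall>\<theta>. D\<theta> c \<theta> \<noteq> 0}"

definition Ds :: "curve \<Rightarrow> curve \<Rightarrow> curve"
  where "Ds c f = (\<lambda>\<theta>. (1 / norm (D\<theta> c \<theta>)) *\<^sub>R D\<theta> f \<theta>)"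

definition integral_ds :: "curve \<Rightarrow> (real \<Rightarrow> real) \<Rightarrow> real"
  where "integral_ds c f = integral {0..2*pi} (\<lambda>\<theta>. f \<theta> * norm (D\<theta> c \<theta>))"

definition L2_ds :: "curve \<Rightarrow> curve \<Rightarrow> curve \<Rightarrow> real"
  where "L2_ds c h k = integral_ds c (\<lambda>\<theta>. h \<theta> \<bullet> k \<theta>)"

text \<open>
  Orientation preserving diffeomorphisms of the circle, given by their lifts to \<open>\<real>\<close>. Two lifts of
  the same diffeomorphism differ by a multiple of \<open>2\<pi>\<close> and hence act in the same way on periodic
  functions.
\<close>

definition Diff_plus :: "(real \<Rightarrow> real) set"
  where "Diff_plus = {\<phi>. smooth_real \<phi> \<and> (\<forall>\<theta>. \<phi> (\<theta> + 2 * pi) = \<phi> \<theta> + 2 * pi) \<and> (\<forall>\<theta>. D\<theta> \<phi> \<theta> > 0)}"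

definition vertical :: "curve \<Rightarrow> (real \<Rightarrow> real) \<Rightarrow> curve"
  where "vertical c a = (\<lambda>\<theta>. a \<theta> *\<^sub>R D\<theta> c \<theta>)"

section \<open>Smoothness on spaces of smooth functions on the circle\<close>

text \<open>
  A smooth family over an open subset \<open>U\<close> of \<open>\<real>\<^sup>n\<close> is a smooth map \<open>U \<rightarrow> C\<^sup>\<infinity>(S\<^sup>1, V)\<close>, which by the
  exponential law is a map \<open>c\<close> for which \<open>(x, \<theta>) \<mapsto> c x \<theta>\<close> is smooth on \<open>U \<times> S\<^sup>1\<close>; here \<open>\<theta>\<close> is the
  coordinate with index \<open>n\<close> of \<open>\<real>\<^sup>n\<^sup>+\<^sup>1\<close>. A map between such function spaces is smooth if it sends
  smooth families, over all finite-dimensional parameter domains, to smooth families. By Boman's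
  theorem this agrees with smoothness along curves (convenient calculus), and on Frechet spaces also
  with the notion based on continuous iterated directional derivatives.
\<close>

definition smooth_family ::
    "nat \<Rightarrow> (nat \<Rightarrow> real) set \<Rightarrow> ((nat \<Rightarrow> real) \<Rightarrow> real \<Rightarrow> 'b::real_normed_vector) \<Rightarrow> bool"
  where "smooth_family n U c \<longleftrightarrow>
    openin (Euclidean_space n) U \<and> (\<forall>x\<in>U. periodic (c x)) \<and>
    smooth_on_Rn (Suc n) {y \<in> topspace (Euclidean_space (Suc n)). y(n := 0) \<in> U}
      (\<lambda>y. c (y(n := 0)) (y n))"

definition Imm_family :: "nat \<Rightarrow> (nat \<Rightarrow> real) set \<Rightarrow> ((nat \<Rightarrow> real) \<Rightarrow> curve) \<Rightarrow> bool"
  where "Imm_family n U c \<longleftrightarrow> smooth_family n U c \<and> (\<forall>x\<in>U. c x \<in> Imm)"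

section \<open>Bilinear tensor fields and forms on the space of immersions\<close>

definition linear_on_C_inf :: "(curve \<Rightarrow> real) \<Rightarrow> bool"
  where "linear_on_C_inf f \<longleftrightarrow>
    (\<forall>h\<in>C_inf. \<forall>k\<in>C_inf. f (\<lambda>\<theta>. h \<theta> + k \<theta>) = f h + f k) \<and>
    (\<forall>r. \<forall>h\<in>C_inf. f (\<lambda>\<theta>. r *\<^sub>R h \<theta>) = r * f h)"

definition bilinear_field :: "(curve \<Rightarrow> curve \<Rightarrow> curve \<Rightarrow> real) \<Rightarrow> bool"
  where "bilinear_field B \<longleftrightarrow>
    (\<forall>c\<in>Imm. \<forall>h\<in>C_inf. linear_on_C_inf (B c h) \<and> linear_on_C_inf (\<lambda>k. B c k h)) \<and>
    (\<forall>n U c h k. Imm_family n U c \<longrightarrow> smooth_family n U h \<longrightarrow> smooth_family n U k \<longrightarrow>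
       smooth_on_Rn n U (\<lambda>x. B (c x) (h x) (k x)))"

definition weak_Riemannian_metric :: "(curve \<Rightarrow> curve \<Rightarrow> curve \<Rightarrow> real) \<Rightarrow> bool"
  where "weak_Riemannian_metric G \<longleftrightarrow> bilinear_field G \<and>
    (\<forall>c\<in>Imm. \<forall>h\<in>C_inf. \<forall>k\<in>C_inf. G c h k = G c k h) \<and>
    (\<forall>c\<in>Imm. \<forall>h\<in>C_inf. h \<noteq> (\<lambda>\<theta>. 0) \<longrightarrow> G c h h > 0)"

definition two_form :: "(curve \<Rightarrow> curve \<Rightarrow> curve \<Rightarrow> real) \<Rightarrow> bool"
  where "two_form \<alpha> \<longleftrightarrow> bilinear_field \<alpha> \<and> (\<forall>c\<in>Imm. \<forall>h\<in>C_inf. \<alpha> c h h = 0)"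

text \<open>
  As \<open>Imm\<close> is open in \<open>C\<^sup>\<infinity>(S\<^sup>1, \<real>\<^sup>3)\<close>, tangent vectors extend to constant vector fields; these
  commute, so no bracket terms occur in the exterior derivatives.
\<close>

definition dir_deriv :: "curve \<Rightarrow> (curve \<Rightarrow> real) \<Rightarrow> curve \<Rightarrow> real"
  where "dir_deriv h F c = deriv (\<lambda>t. F (\<lambda>\<theta>. c \<theta> + t *\<^sub>R h \<theta>)) 0"

definition d_one_form :: "(curve \<Rightarrow> curve \<Rightarrow> real) \<Rightarrow> curve \<Rightarrow> curve \<Rightarrow> curve \<Rightarrow> real"
  where "d_one_form \<alpha> c h k = dir_deriv h (\<lambda>c. \<alpha> c k) c - dir_deriv k (\<lambda>c. \<alpha> c h) c"

definition d_two_form ::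
    "(curve \<Rightarrow> curve \<Rightarrow> curve \<Rightarrow> real) \<Rightarrow> curve \<Rightarrow> curve \<Rightarrow> curve \<Rightarrow> curve \<Rightarrow> real"
  where "d_two_form \<alpha> c h k l =
    dir_deriv h (\<lambda>c. \<alpha> c k l) c - dir_deriv k (\<lambda>c. \<alpha> c h l) c + dir_deriv l (\<lambda>c. \<alpha> c h k) c"

definition closed_two_form :: "(curve \<Rightarrow> curve \<Rightarrow> curve \<Rightarrow> real) \<Rightarrow> bool"
  where "closed_two_form \<alpha> \<longleftrightarrow>
    (\<forall>c\<in>Imm. \<forall>h\<in>C_inf. \<forall>k\<in>C_inf. \<forall>l\<in>C_inf. d_two_form \<alpha> c h k l = 0)"

section \<open>Elliptic pseudodifferential operators on the circle\<close>

definition partial1 :: "(real \<Rightarrow> real \<Rightarrow> 'b::real_normed_vector) \<Rightarrow> real \<Rightarrow> real \<Rightarrow> 'b"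
  where "partial1 a = (\<lambda>\<theta> \<xi>. vector_derivative (\<lambda>t. a t \<xi>) (at \<theta>))"

definition partial2 :: "(real \<Rightarrow> real \<Rightarrow> 'b::real_normed_vector) \<Rightarrow> real \<Rightarrow> real \<Rightarrow> 'b"
  where "partial2 a = (\<lambda>\<theta> \<xi>. vector_derivative (\<lambda>t. a \<theta> t) (at \<xi>))"

text \<open>The Hoermander class \<open>S\<^sup>m\<^sub>1\<^sub>,\<^sub>0(S\<^sup>1 \<times> \<real>)\<close> of matrix-valued symbols.\<close>

definition symbol :: "real \<Rightarrow> (real \<Rightarrow> real \<Rightarrow> complex^3^3) \<Rightarrow> bool"
  where "symbol m a \<longleftrightarrow>
    (\<forall>\<xi>. periodic (\<lambda>\<theta>. a \<theta> \<xi>)) \<and>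
    smooth_on_Rn 2 (topspace (Euclidean_space 2)) (\<lambda>x. a (x 0) (x 1)) \<and>
    (\<forall>i j. \<exists>C. \<forall>\<theta> \<xi>. norm ((partial1 ^^ i) ((partial2 ^^ j) a) \<theta> \<xi>)
                       \<le> C * (1 + \<bar>\<xi>\<bar>) powr (m - real j))"

definition elliptic_symbol :: "real \<Rightarrow> (real \<Rightarrow> real \<Rightarrow> complex^3^3) \<Rightarrow> bool"
  where "elliptic_symbol m a \<longleftrightarrow> symbol m a \<and>
    (\<exists>R C. \<forall>\<theta> \<xi>. \<bar>\<xi>\<bar> \<ge> R \<longrightarrow> invertible (a \<theta> \<xi>) \<and>
        norm (matrix_inv (a \<theta> \<xi>)) \<le> C * (1 + \<bar>\<xi>\<bar>) powr (- m))"

definition fourier_coeff :: "curve \<Rightarrow> int \<Rightarrow> complex^3"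
  where "fourier_coeff h k =
    (\<chi> j. integral {0..2*pi} (\<lambda>\<theta>. cis (- (of_int k * \<theta>)) * complex_of_real (h \<theta> $ j)) / (2 * pi))"

text \<open>
  For a symbol that is periodic in \<open>\<theta>\<close>, the Kohn--Nirenberg quantization
  \<open>(2\<pi>)\<^sup>-\<^sup>1 \<integral> e\<^sup>i\<^sup>\<theta>\<^sup>\<xi> a(\<theta>, \<xi>) \<^bold>F h(\<xi>) d\<xi>\<close> of a periodic function \<open>h\<close>, whose Fourier transform \<open>\<^bold>F h\<close> is
  supported on the integers, is the Fourier series below. On the circle every pseudodifferential
  operator has a global symbol of this kind (smoothing operators being those whose symbol lies in all
  the classes \<open>S\<^sup>m\<close>), so that no charts are needed. The operator acts on real functions, its symbol is
  complex.
\<close>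

definition quantization :: "(real \<Rightarrow> real \<Rightarrow> complex^3^3) \<Rightarrow> (curve \<Rightarrow> curve) \<Rightarrow> bool"
  where "quantization a A \<longleftrightarrow> (\<forall>h\<in>C_inf. \<forall>\<theta>.
    ((\<lambda>k::int. cis (of_int k * \<theta>) *s (a \<theta> (of_int k) *v fourier_coeff h k))
       has_sum (\<chi> j. complex_of_real (A h \<theta> $ j))) UNIV)"

definition elliptic_pseudodifferential :: "(curve \<Rightarrow> curve) \<Rightarrow> bool"
  where "elliptic_pseudodifferential A \<longleftrightarrow> (\<exists>m a. elliptic_symbol m a \<and> quantization a A)"

section \<open>Inertia operators\<close>

definition smooth_operator_field :: "(curve \<Rightarrow> curve \<Rightarrow> curve) \<Rightarrow> bool"
  where "smooth_operator_field L \<longleftrightarrow>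
    (\<forall>c\<in>Imm. \<forall>h\<in>C_inf. L c h \<in> C_inf) \<and>
    (\<forall>c\<in>Imm. \<forall>h\<in>C_inf. \<forall>k\<in>C_inf. L c (\<lambda>\<theta>. h \<theta> + k \<theta>) = (\<lambda>\<theta>. L c h \<theta> + L c k \<theta>)) \<and>
    (\<forall>c\<in>Imm. \<forall>r. \<forall>h\<in>C_inf. L c (\<lambda>\<theta>. r *\<^sub>R h \<theta>) = (\<lambda>\<theta>. r *\<^sub>R L c h \<theta>)) \<and>
    (\<forall>n U c h. Imm_family n U c \<longrightarrow> smooth_family n U h \<longrightarrow>
       smooth_family n U (\<lambda>x. L (c x) (h x)))"

definition metric_of :: "(curve \<Rightarrow> curve \<Rightarrow> curve) \<Rightarrow> curve \<Rightarrow> curve \<Rightarrow> curve \<Rightarrow> real"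
  where "metric_of L c h k = L2_ds c (L c h) k"

definition SO3_equivariant :: "(curve \<Rightarrow> curve \<Rightarrow> curve) \<Rightarrow> bool"
  where "SO3_equivariant L \<longleftrightarrow> (\<forall>Q. rotation_matrix Q \<longrightarrow>
    (\<forall>c\<in>Imm. \<forall>h\<in>C_inf. L (\<lambda>\<theta>. Q *v c \<theta>) (\<lambda>\<theta>. Q *v h \<theta>) = (\<lambda>\<theta>. Q *v L c h \<theta>)))"

definition inertia_operator :: "(curve \<Rightarrow> curve \<Rightarrow> curve) \<Rightarrow> bool"
  where "inertia_operator L \<longleftrightarrow>
    smooth_operator_field L \<and>
    (\<forall>c\<in>Imm. elliptic_pseudodifferential (L c)) \<and>
    (\<forall>c\<in>Imm. \<forall>h\<in>C_inf. \<forall>k\<in>C_inf. L2_ds c (L c h) k = L2_ds c h (L c k)) \<and>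
    weak_Riemannian_metric (metric_of L) \<and>
    SO3_equivariant L"

definition Diff_equivariant :: "(curve \<Rightarrow> curve \<Rightarrow> curve) \<Rightarrow> bool"
  where "Diff_equivariant L \<longleftrightarrow>
    (\<forall>\<phi>\<in>Diff_plus. \<forall>c\<in>Imm. \<forall>h\<in>C_inf. L (c \<circ> \<phi>) (h \<circ> \<phi>) = L c h \<circ> \<phi>)"

definition Theta :: "(curve \<Rightarrow> curve \<Rightarrow> curve) \<Rightarrow> curve \<Rightarrow> curve \<Rightarrow> real"
  where "Theta L c h = integral_ds c (\<lambda>\<theta>. cross3 (c \<theta>) (Ds c c \<theta>) \<bullet> L c h \<theta>)"

definition Omega :: "(curve \<Rightarrow> curve \<Rightarrow> curve) \<Rightarrow> curve \<Rightarrow> curve \<Rightarrow> curve \<Rightarrow> real"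
  where "Omega L c h k = - d_one_form (Theta L) c h k"

section \<open>The shape space and its differential forms\<close>

definition proj :: "curve \<Rightarrow> curve set"
  where "proj c = {c \<circ> \<phi> |\<phi>. \<phi> \<in> Diff_plus}"

definition B_i :: "curve set set"
  where "B_i = proj ` Imm"

text \<open>
  Two pairs \<open>(h, k)\<close> at \<open>c\<close> and \<open>(h', k')\<close> at \<open>c'\<close> define the same pair of tangent vectors of \<open>B_i\<close>
  iff some \<open>\<phi>\<close> in \<open>Diff_plus\<close> takes \<open>c\<close> to \<open>c'\<close> and \<open>(h, k)\<close> to \<open>(h', k')\<close> up to vertical vectors.
  The two vectors are transported by one common \<open>\<phi>\<close>: where the isotropy group of \<open>c\<close> is nontrivial
  (e.g. multiply covered curves), \<open>B_i\<close> is an orbifold, and a form in an orbifold chart is a form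
  invariant under the diagonal action of the isotropy group.
\<close>

definition tangent_pair :: "curve \<Rightarrow> curve \<Rightarrow> curve \<Rightarrow> (curve \<times> curve \<times> curve) set"
  where "tangent_pair c h k =
    {(c \<circ> \<phi>,
      \<lambda>\<theta>. (h \<circ> \<phi>) \<theta> + vertical (c \<circ> \<phi>) a \<theta>,
      \<lambda>\<theta>. (k \<circ> \<phi>) \<theta> + vertical (c \<circ> \<phi>) b \<theta>) |\<phi> a b.
     \<phi> \<in> Diff_plus \<and> a \<in> C_inf \<and> b \<in> C_inf}"

definition tangent_pairs :: "curve set \<Rightarrow> (curve \<times> curve \<times> curve) set set"
  where "tangent_pairs p = {tangent_pair c h k |c h k. c \<in> Imm \<and> proj c = p \<and> h \<in> C_inf \<and> k \<in> C_inf}"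

text \<open>
  A tensor \<open>\<beta>\<close> on \<open>B_i\<close> takes a point of \<open>B_i\<close> and a pair of tangent vectors at this point (and is
  \<open>undefined\<close> elsewhere). The smooth structure of \<open>B_i\<close> is the quotient structure, so smoothness and
  the exterior derivative of \<open>\<beta>\<close> are determined by the pullback along the projection.
\<close>

type_synonym shape_tensor = "curve set \<Rightarrow> (curve \<times> curve \<times> curve) set \<Rightarrow> real"

definition pullback :: "shape_tensor \<Rightarrow> curve \<Rightarrow> curve \<Rightarrow> curve \<Rightarrow> real"
  where "pullback \<beta> c h k = \<beta> (proj c) (tangent_pair c h k)"

definition presymplectic_B_i :: "shape_tensor \<Rightarrow> bool"
  where "presymplectic_B_i \<beta> \<longleftrightarrow>
    (\<forall>p X. \<not> (p \<in> B_i \<and> X \<in> tangent_pairs p) \<longrightarrow> \<beta> p X = undefined) \<and>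
    two_form (pullback \<beta>) \<and> closed_two_form (pullback \<beta>)"

definition factors_to :: "(curve \<Rightarrow> curve \<Rightarrow> curve \<Rightarrow> real) \<Rightarrow> shape_tensor \<Rightarrow> bool"
  where "factors_to \<alpha> \<beta> \<longleftrightarrow> (\<forall>c\<in>Imm. \<forall>h\<in>C_inf. \<forall>k\<in>C_inf. \<alpha> c h k = pullback \<beta> c h k)"

end

theory Submission
  imports Defs "HOL-Library.Periodic_Fun"
begin

text \<open>
  The norm of \<open>c\<^sub>\<theta>\<close> cancels in \<open>\<Theta>\<close>, which becomes \<open>\<Theta>\<^sub>c(h) = \<integral> \<langle>c \<times> c\<^sub>\<theta>, L\<^sub>c h\<rangle> d\<theta>\<close>. Hence \<open>\<Theta>\<close> is smooth,
  invariant under reparametrisation, and zero on vertical vectors, as \<open>c \<times> c\<^sub>\<theta>\<close> is orthogonal to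
  \<open>c\<close> and \<open>c\<^sub>\<theta>\<close>. For a vertical field \<open>X = a c\<^sub>\<theta>\<close>, Cartan's formula
  \<open>i\<^sub>X d\<Theta> = \<L>\<^sub>X \<Theta> - d(i\<^sub>X \<Theta>)\<close> then shows that \<open>d\<Theta>\<close> is horizontal: differentiating
  \<open>\<Theta>\<^bsub>c \<circ> \<phi>\<^esub>(k \<circ> \<phi>) = \<Theta>\<^sub>c(k)\<close> along \<open>\<phi> = id + t a\<close>, and \<open>\<Theta>\<^sub>c(a c\<^sub>\<theta>) = 0\<close> along \<open>c + t k\<close>,
  identifies both directional derivatives in \<open>d\<Theta>(a c\<^sub>\<theta>, k)\<close> with \<open>- \<Theta>\<^sub>c(a k\<^sub>\<theta>)\<close>.
\<close>

section \<open>Calculus of \<open>C\<^sup>k\<close> functions\<close>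

text \<open>The obstacle is that \<open>dir_deriv\<close> only sees straight lines c + t h with a
  constant direction, whereas a flow by reparametrisations bends, and that smoothness is available
  only through finite-dimensional families. Each argument on the space of immersions therefore
  becomes a statement about real functions of finitely many parameters: additivity in the direction
  is the chain rule on a diagonal, closedness is the symmetry of mixed partial derivatives, and the
  Lie derivative along a vertical field is read off a two-parameter surface whose diagonal is the
  reparametrised curve. The term in a k_\<theta> arises twice because \<open>dir_deriv\<close>
  freezes the inserted vector: invariance moves k to k o \<phi>, so freezing k leaves a remainder,
  and a frozen a c_\<theta> is vertical at c but in general no longer at c + t k. For the quotient,
  a class of pairs is handled through one common \<phi> and two vertical corrections, and skew
  symmetry carries horizontality from the first slot to the second.\<close>

lemma mem_Euclidean_space: "x \<in> topspace (Euclidean_space n) \<longleftrightarrow> (\<forall>i\<ge>n. x i = 0)"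
  by (simp add: topspace_Euclidean_space)

lemma openin_Euclidean_space_iff:
  "openin (Euclidean_space n) U \<longleftrightarrow> (\<exists>T. open T \<and> U = T \<inter> topspace (Euclidean_space n))"
  by (simp add: Euclidean_space_def openin_subtopology euclidean_product_topology)

lemma continuous_on_coordinate:
  fixes f :: "'a::topological_space \<Rightarrow> 'b \<Rightarrow> 'c::topological_space"
  shows "continuous_on S f \<Longrightarrow> continuous_on S (\<lambda>x. f x i)"
  by (rule continuous_on_product_then_coordinatewise)

lemma continuous_on_fun_upd:
  fixes f :: "'a::topological_space \<Rightarrow> 'b \<Rightarrow> 'c::topological_space"
  assumes "continuous_on S f" "continuous_on S g"
  shows "continuous_on S (\<lambda>x. (f x)(i := g x))"
proof (rule continuous_on_coordinatewise_then_product)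
  show "continuous_on S (\<lambda>x. ((f x)(i := g x)) j)" for j
    using assms continuous_on_product_then_coordinatewise[OF assms(1)] by (cases "j = i") auto
qed

text \<open>\<open>U\<close> is only the trace of an open set \<open>T\<close> on the subspace; as
  \<open>g\<close> takes its values in the subspace, the preimages of \<open>U\<close> and of
  \<open>T\<close> under \<open>g\<close> agree.\<close>

lemma open_Euclidean_preimage:
  fixes g :: "'a::topological_space \<Rightarrow> nat \<Rightarrow> real"
  assumes U: "openin (Euclidean_space n) U" and g: "continuous_on S g" and S: "open S"
    and mem: "\<And>x. x \<in> S \<Longrightarrow> g x \<in> topspace (Euclidean_space n)"
  shows "open {x \<in> S. g x \<in> U}"
proof -
  obtain T where T: "open T" "U = T \<inter> topspace (Euclidean_space n)"
    using U by (auto simp: openin_Euclidean_space_iff)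
  have "{x \<in> S. g x \<in> U} = g -` T \<inter> S" using T mem by auto
  thus ?thesis using g T(1) unfolding continuous_on_open_vimage[OF S] by auto
qed

lemma openin_Euclidean_preimage:
  fixes g :: "(nat \<Rightarrow> real) \<Rightarrow> nat \<Rightarrow> real"
  assumes U: "openin (Euclidean_space n) U" and V: "openin (Euclidean_space m) V"
    and g: "continuous_on V g" and mem: "\<And>x. x \<in> V \<Longrightarrow> g x \<in> topspace (Euclidean_space n)"
  shows "openin (Euclidean_space m) {x \<in> V. g x \<in> U}"
proof -
  obtain T where T: "open T" "U = T \<inter> topspace (Euclidean_space n)"
    using U by (auto simp: openin_Euclidean_space_iff)
  obtain S where S: "open S" "V = S \<inter> topspace (Euclidean_space m)"
    using V by (auto simp: openin_Euclidean_space_iff)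
  obtain W where W: "open W" "W \<inter> V = g -` T \<inter> V"
    using g T(1) unfolding continuous_on_open_invariant by metis
  have "{x \<in> V. g x \<in> U} = (W \<inter> S) \<inter> topspace (Euclidean_space m)"
    using T W S mem by auto
  thus ?thesis unfolding openin_Euclidean_space_iff using open_Int[OF W(1) S(1)] by blast
qed

lemma fun_upd_mem_Euclidean_space:
  assumes "x \<in> topspace (Euclidean_space n)" "i < n"
  shows "x(i := t) \<in> topspace (Euclidean_space n)"
  using assms by (auto simp: mem_Euclidean_space)

lemma openin_Euclidean_topspace:
  "openin (Euclidean_space n) U \<Longrightarrow> x \<in> U \<Longrightarrow> x \<in> topspace (Euclidean_space n)"
  using openin_subset by blast

text \<open>This is what makes a partial derivative \<open>at (x i)\<close> depend only on the
  values of the function on \<open>U\<close>: the coordinate line stays in \<open>U\<close> near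
  \<open>x i\<close>.\<close>

lemma open_coordinate_line:
  assumes U: "openin (Euclidean_space n) U" and x: "x \<in> U" and i: "i < n"
  shows "open {t. x(i := t) \<in> U}"
proof -
  have "continuous_on UNIV (\<lambda>t. x(i := t))"
    by (rule continuous_on_fun_upd[OF continuous_on_const continuous_on_id])
  from open_Euclidean_preimage[OF U this open_UNIV
      fun_upd_mem_Euclidean_space[OF openin_Euclidean_topspace[OF U x] i]]
  show ?thesis by simp
qed

section \<open>Closure properties of C^k functions\<close>

lemma Ck_on_continuous: "Ck_on k n U f \<Longrightarrow> continuous_on U f"
  by (cases k) simp_all

lemma Ck_on_SucE:
  assumes "Ck_on (Suc k) n U f" "i < n"
  obtains g where "Ck_on k n U g" "\<And>x. x \<in> U \<Longrightarrow> ((\<lambda>t. f (x(i := t))) has_vector_derivative g x) (at (x i))"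
proof -
  have "\<exists>g. Ck_on k n U g \<and> (\<forall>x\<in>U. ((\<lambda>t. f (x(i := t))) has_vector_derivative g x) (at (x i)))"
    using assms by simp
  thus thesis using that by metis
qed

text \<open>The difference quotients leave the point \<open>x\<close> but, \<open>U\<close> being
  open, not the set \<open>U\<close>; so the witnesses for \<open>f\<close> serve for
  \<open>g\<close> unchanged.\<close>

lemma Ck_on_cong_imp:
  assumes U: "openin (Euclidean_space n) U" and eq: "\<And>x. x \<in> U \<Longrightarrow> f x = g x"
    and f: "Ck_on k n U f"
  shows "Ck_on k n U g"
proof (cases k)
  case 0
  have "continuous_on U g" by (rule continuous_on_eq[OF Ck_on_continuous[OF f] eq])
  thus ?thesis using 0 by simp
next
  case (Suc j)
  have "\<exists>d. Ck_on j n U d \<and> (\<forall>x\<in>U. ((\<lambda>t. g (x(i := t))) has_vector_derivative d x) (at (x i)))"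
    if i: "i < n" for i
  proof -
    obtain d where d: "Ck_on j n U d"
      "\<And>x. x \<in> U \<Longrightarrow> ((\<lambda>t. f (x(i := t))) has_vector_derivative d x) (at (x i))"
      using Ck_on_SucE[OF f[unfolded Suc] i] by blast
    have "((\<lambda>t. g (x(i := t))) has_vector_derivative d x) (at (x i))" if x: "x \<in> U" for x
      by (rule has_vector_derivative_transform_within_open[OF d(2)[OF x] open_coordinate_line[OF U x i]])
        (use x eq in simp_all)
    thus ?thesis using d(1) by blast
  qed
  moreover have "continuous_on U g"
    by (rule continuous_on_eq[OF Ck_on_continuous[OF f] eq])
  ultimately show ?thesis unfolding Suc Ck_on.simps by blast
qed

lemma Ck_on_Suc_imp: "Ck_on (Suc k) n U f \<Longrightarrow> Ck_on k n U f"
proof (induction k arbitrary: f)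
  case (Suc k)
  have "continuous_on U f" using Suc.prems by (rule Ck_on_continuous)
  moreover have "\<exists>g. Ck_on k n U g \<and> (\<forall>x\<in>U. ((\<lambda>t. f (x(i := t))) has_vector_derivative g x) (at (x i)))"
    if "i < n" for i
    using Suc.prems Suc.IH that by (subst (asm) Ck_on.simps(2)) blast
  ultimately show ?case by simp
qed auto

lemma Ck_on_const: "Ck_on k n U (\<lambda>x. c)"
proof (induction k arbitrary: c)
  case (Suc k)
  show ?case using Suc[of 0] by (auto intro!: exI[of _ "\<lambda>x. 0"])
qed simp

lemma Ck_on_coord: "Ck_on k n U (\<lambda>x. x j)"
proof (cases k)
  case 0
  thus ?thesis by (auto intro: continuous_on_coordinate continuous_intros)
next
  case (Suc l)
  have "((\<lambda>t. (x(i := t)) j) has_vector_derivative (if i = j then 1 else 0)) (at (x i))" for x :: "nat \<Rightarrow> real" and i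
    by (auto intro: derivative_eq_intros)
  hence "\<exists>g. Ck_on l n U g \<and> (\<forall>x\<in>U. ((\<lambda>t. (x(i := t)) j) has_vector_derivative g x) (at (x i)))" for i
    using Ck_on_const[of l n U "if i = j then 1 else 0"] by blast
  thus ?thesis unfolding Suc Ck_on.simps
    using continuous_on_coordinate[OF continuous_on_id, of U j] by blast
qed

lemma Ck_on_add:
  "Ck_on k n U f \<Longrightarrow> Ck_on k n U g \<Longrightarrow> Ck_on k n U (\<lambda>x. f x + g x)"
proof (induction k arbitrary: f g)
  case (Suc k)
  show ?case unfolding Ck_on.simps
  proof (intro conjI allI impI)
    show "continuous_on U (\<lambda>x. f x + g x)"
      by (intro continuous_on_add) (use Suc.prems Ck_on_continuous in blast)+
    fix i assume i: "i < n"
    obtain f' where f': "Ck_on k n U f'"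
      "\<And>x. x \<in> U \<Longrightarrow> ((\<lambda>t. f (x(i := t))) has_vector_derivative f' x) (at (x i))"
      using Ck_on_SucE[OF Suc.prems(1) i] by blast
    obtain g' where g': "Ck_on k n U g'"
      "\<And>x. x \<in> U \<Longrightarrow> ((\<lambda>t. g (x(i := t))) has_vector_derivative g' x) (at (x i))"
      using Ck_on_SucE[OF Suc.prems(2) i] by blast
    show "\<exists>d. Ck_on k n U d \<and> (\<forall>x\<in>U. ((\<lambda>t. f (x(i := t)) + g (x(i := t))) has_vector_derivative d x) (at (x i)))"
      by (rule exI[of _ "\<lambda>x. f' x + g' x"])
        (intro conjI ballI Suc.IH has_vector_derivative_add f' g')
  qed
qed (simp add: continuous_on_add)

lemma Ck_on_sum:
  assumes "\<And>j. j \<in> A \<Longrightarrow> Ck_on k n U (f j)"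
  shows "Ck_on k n U (\<lambda>x. \<Sum>j\<in>A. f j x)"
  using assms
proof (induction A rule: infinite_finite_induct)
  case (insert a A)
  thus ?case using Ck_on_add[of k n U "f a" "\<lambda>x. \<Sum>j\<in>A. f j x"] by simp
qed (simp_all add: Ck_on_const)

text \<open>By the Leibniz rule the partial derivative is again a sum of values of \<open>B\<close>
  on C^k functions, which closes the induction. A general \<open>B\<close> covers scalar multiples,
  products, inner products and cross products at once.\<close>

lemma Ck_on_bilinear:
  assumes B: "bounded_bilinear B"
  shows "Ck_on k n U f \<Longrightarrow> Ck_on k n U g \<Longrightarrow> Ck_on k n U (\<lambda>x. B (f x) (g x))"
proof (induction k arbitrary: f g)
  case 0
  thus ?case using bounded_bilinear.continuous_on[OF B] by simp
next
  case (Suc k)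
  \<comment> \<open>Each Leibniz term contains one factor that is not differentiated; it enters the
    induction hypothesis with its order lowered by one.\<close>
  note fg = Suc.prems[THEN Ck_on_Suc_imp]
  show ?case unfolding Ck_on.simps
  proof (intro conjI allI impI)
    show "continuous_on U (\<lambda>x. B (f x) (g x))"
      by (intro bounded_bilinear.continuous_on[OF B]) (use Suc.prems Ck_on_continuous in blast)+
    fix i assume i: "i < n"
    obtain f' where f': "Ck_on k n U f'"
      "\<And>x. x \<in> U \<Longrightarrow> ((\<lambda>t. f (x(i := t))) has_vector_derivative f' x) (at (x i))"
      using Ck_on_SucE[OF Suc.prems(1) i] by blast
    obtain g' where g': "Ck_on k n U g'"
      "\<And>x. x \<in> U \<Longrightarrow> ((\<lambda>t. g (x(i := t))) has_vector_derivative g' x) (at (x i))"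
      using Ck_on_SucE[OF Suc.prems(2) i] by blast
    have "((\<lambda>t. B (f (x(i := t))) (g (x(i := t)))) has_vector_derivative B (f x) (g' x) + B (f' x) (g x)) (at (x i))"
      if "x \<in> U" for x
      using bounded_bilinear.has_vector_derivative[OF B f'(2)[OF that] g'(2)[OF that]]
      by simp
    moreover have "Ck_on k n U (\<lambda>x. B (f x) (g' x) + B (f' x) (g x))"
      by (intro Ck_on_add Suc.IH fg f' g')
    ultimately show "\<exists>d. Ck_on k n U d \<and> (\<forall>x\<in>U. ((\<lambda>t. B (f (x(i := t))) (g (x(i := t)))) has_vector_derivative d x) (at (x i)))"
      by blast
  qed
qed

lemmas Ck_on_scaleR = Ck_on_bilinear[OF bounded_bilinear_scaleR]

text \<open>The coordinates of the curve \<open>\<gamma>\<close> are released one at a time; each new coordinate is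
  differentiated along the curve by means of the two-variable criterion.\<close>

lemma chain_rule_curve:
  fixes f :: "(nat \<Rightarrow> real) \<Rightarrow> 'b::real_normed_vector"
  assumes V: "openin (Euclidean_space m) V"
    and T: "open T" "t0 \<in> T"
    and cont: "\<And>j. j < m \<Longrightarrow> continuous_on T (\<lambda>t. \<gamma> t j)"
    and mem: "\<And>t. t \<in> T \<Longrightarrow> \<gamma> t \<in> V"
    and d\<gamma>: "\<And>j. j < m \<Longrightarrow> ((\<lambda>t. \<gamma> t j) has_vector_derivative \<gamma>' j) (at t0)"
    and df: "\<And>j x. j < m \<Longrightarrow> x \<in> V \<Longrightarrow> ((\<lambda>t. f (x(j := t))) has_vector_derivative f' j x) (at (x j))"
    and cf: "\<And>j. j < m \<Longrightarrow> continuous_on V (f' j)"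
  shows "((\<lambda>t. f (\<gamma> t)) has_vector_derivative (\<Sum>j<m. \<gamma>' j *\<^sub>R f' j (\<gamma> t0))) (at t0)"
proof -
  have \<gamma>0: "\<gamma> t j = 0" if "t \<in> T" "j \<ge> m" for t j
    using openin_Euclidean_topspace[OF V mem[OF that(1)]] that(2) by (auto simp: mem_Euclidean_space)
  \<comment> \<open>\<open>\<Gamma> 0\<close> is constant and \<open>\<Gamma> m\<close> agrees with
    \<open>\<gamma>\<close> on \<open>T\<close>, so an induction on \<open>l\<close> starts
    trivially and ends at the claim.\<close>
  define \<Gamma> where "\<Gamma> l t = (\<lambda>i. if i < l then \<gamma> t i else \<gamma> t0 i)" for l t
  have \<Gamma>t0: "\<Gamma> l t0 = \<gamma> t0" for l by (auto simp: \<Gamma>_def)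
  have cont\<Gamma>: "continuous_on T (\<Gamma> l)" for l
  proof (rule continuous_on_coordinatewise_then_product)
    fix i
    show "continuous_on T (\<lambda>t. \<Gamma> l t i)"
    proof (cases "i < m")
      case True
      thus ?thesis using cont[of i] by (cases "i < l") (auto simp: \<Gamma>_def)
    next
      case False
      have "\<Gamma> l t i = 0" if "t \<in> T" for t
        using False \<gamma>0[of t i] \<gamma>0[of t0 i] T that by (auto simp: \<Gamma>_def)
      thus ?thesis by (metis (no_types, lifting) continuous_on_cong continuous_on_const)
    qed
  qed
  have "((\<lambda>t. f (\<Gamma> l t)) has_vector_derivative (\<Sum>j<l. \<gamma>' j *\<^sub>R f' j (\<gamma> t0))) (at t0)" if "l \<le> m" for l
    using that
  proof (induction l)
    case 0
    show ?case by (simp add: \<Gamma>_def)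
  next
    case (Suc l)
    hence l: "l < m" by simp
    \<comment> \<open>The coordinate \<open>l\<close> is decoupled from the time \<open>s\<close>
      and becomes an independent variable \<open>u\<close>; substituting
      \<open>u = \<gamma> t l\<close> afterwards gives \<open>\<Gamma> (Suc l)\<close>.\<close>
    define p where "p = (\<lambda>(s, u). (\<Gamma> l s)(l := u))"
    define u0 where "u0 = \<gamma> t0 l"
    have pc: "continuous_on (T \<times> UNIV) p"
      unfolding p_def split_beta
      by (intro continuous_on_fun_upd continuous_on_snd continuous_on_id
          continuous_on_compose2[OF cont\<Gamma> continuous_on_fst[OF continuous_on_id]]) auto
    have pm: "p z \<in> topspace (Euclidean_space m)" if "z \<in> T \<times> UNIV" for z
      using that \<gamma>0 T(2) l by (auto simp: p_def mem_Euclidean_space \<Gamma>_def split: prod.splits)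
    have op: "open {z \<in> T \<times> UNIV. p z \<in> V}"
      by (rule open_Euclidean_preimage[OF V pc _ pm]) (use T in \<open>auto intro: open_Times\<close>)
    have p0: "p (t0, u0) = \<gamma> t0" by (auto simp: p_def u0_def \<Gamma>t0)
    hence "(t0, u0) \<in> {z \<in> T \<times> UNIV. p z \<in> V}" using T mem by auto
    from open_prod_elim[OF op this]
    obtain A B where AB: "open A" "open B" "(t0, u0) \<in> A \<times> B" "A \<times> B \<subseteq> {z \<in> T \<times> UNIV. p z \<in> V}" .
    hence tu: "t0 \<in> A" "u0 \<in> B" by simp_all
    obtain e where e: "e > 0" "ball u0 e \<subseteq> B" using AB(2) tu(2) open_contains_ball by blast
    \<comment> \<open>A ball, because the two-variable criterion asks for a convex range of the
      second variable.\<close>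
    define Y where "Y = ball u0 e"
    have pV: "p z \<in> V" if "z \<in> A \<times> Y" for z using that AB(4) e unfolding Y_def by blast
    have AT: "A \<subseteq> T" using AB(4) tu(2) by auto
    define F where "F = (\<lambda>s u. f (p (s, u)))"
    have Fd: "((\<lambda>(x, y). F x y) has_derivative
        (\<lambda>(tx, ty). tx *\<^sub>R (\<Sum>j<l. \<gamma>' j *\<^sub>R f' j (\<gamma> t0)) + blinfun_scaleR_left (f' l (p (t0, u0))) ty))
        (at (t0, u0) within A \<times> Y)"
    \<comment> \<open>The criterion is asymmetric, as the situation is: the derivative in
      \<open>s\<close> is known from the induction hypothesis only at the base point, the one in
      \<open>u\<close> exists throughout and is continuous.\<close>
    proof (rule has_derivative_partialsI[where fy = "\<lambda>s u. blinfun_scaleR_left (f' l (p (s, u)))"])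
      have "(\<lambda>x. F x u0) = (\<lambda>t. f (\<Gamma> l t))"
        by (auto simp: F_def p_def \<Gamma>_def u0_def fun_eq_iff intro!: arg_cong[where f = f])
      thus "((\<lambda>x. F x u0) has_derivative (\<lambda>tx. tx *\<^sub>R (\<Sum>j<l. \<gamma>' j *\<^sub>R f' j (\<gamma> t0)))) (at t0 within A)"
        using Suc by (auto simp: has_vector_derivative_def intro: has_derivative_at_withinI)
    next
      fix s u assume su: "s \<in> A" "u \<in> Y"
      have "((\<lambda>t. f ((p (s, u))(l := t))) has_vector_derivative f' l (p (s, u))) (at (p (s, u) l))"
        by (rule df[OF l]) (use pV su in auto)
      hence "((\<lambda>t. F s t) has_vector_derivative f' l (p (s, u))) (at u)"
        by (simp add: F_def p_def)
      thus "(F s has_derivative blinfun_apply (blinfun_scaleR_left (f' l (p (s, u))))) (at u within Y)"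
        by (auto simp: has_vector_derivative_def intro: has_derivative_at_withinI)
    next
      have "continuous_on (A \<times> Y) (\<lambda>z. f' l (p z))"
        by (rule continuous_on_compose2[OF cf[OF l] continuous_on_subset[OF pc]]) (use pV AT in auto)
      hence "continuous_on (A \<times> Y) (\<lambda>z. blinfun_scaleR_left (f' l (p z)))"
        by (rule bounded_linear.continuous_on[OF bounded_linear_blinfun_scaleR_left])
      thus "continuous (at (t0, u0) within A \<times> Y) (\<lambda>(x, y). blinfun_scaleR_left (f' l (p (x, y))))"
        using tu e by (auto simp: continuous_on_eq_continuous_within Y_def split_beta')
    qed (use e in \<open>auto simp: Y_def\<close>)
    have opn: "open (A \<times> Y)" using AB by (auto simp: Y_def intro: open_Times)
    have mem0: "(t0, u0) \<in> A \<times> Y" using tu e by (auto simp: Y_def)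
    have Fd': "((\<lambda>(x, y). F x y) has_derivative
        (\<lambda>(tx, ty). tx *\<^sub>R (\<Sum>j<l. \<gamma>' j *\<^sub>R f' j (\<gamma> t0)) + ty *\<^sub>R f' l (\<gamma> t0))) (at (t0, u0))"
      using Fd by (simp add: at_within_open[OF mem0 opn] p0)
    have g: "((\<lambda>t. (t, \<gamma> t l)) has_derivative (\<lambda>h. (h, h *\<^sub>R \<gamma>' l))) (at t0)"
      using d\<gamma>[OF l] by (auto simp: has_vector_derivative_def intro!: has_derivative_Pair)
    have "((\<lambda>t. F t (\<gamma> t l)) has_derivative
        (\<lambda>h. h *\<^sub>R (\<Sum>j<l. \<gamma>' j *\<^sub>R f' j (\<gamma> t0)) + (h *\<^sub>R \<gamma>' l) *\<^sub>R f' l (\<gamma> t0))) (at t0)"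
      using has_derivative_compose[OF g Fd'[unfolded u0_def]] by simp
    moreover have "F t (\<gamma> t l) = f (\<Gamma> (Suc l) t)" for t
      unfolding F_def p_def by (rule arg_cong[where f = f]) (auto simp: \<Gamma>_def fun_eq_iff)
    ultimately show ?case
      by (simp add: has_vector_derivative_def scaleR_add_right)
  qed
  from this[of m] have main: "((\<lambda>t. f (\<Gamma> m t)) has_vector_derivative (\<Sum>j<m. \<gamma>' j *\<^sub>R f' j (\<gamma> t0))) (at t0)"
    by simp
  show ?thesis
  proof (rule has_vector_derivative_transform_within_open[OF main T])
    fix t assume "t \<in> T"
    have "\<Gamma> m t = \<gamma> t"
    proof
      fix i show "\<Gamma> m t i = \<gamma> t i"
        using \<gamma>0[of t i] \<gamma>0[of t0 i] T(2) \<open>t \<in> T\<close> by (cases "i < m") (auto simp: \<Gamma>_def)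
    qed
    thus "f (\<Gamma> m t) = f (\<gamma> t)" by simp
  qed
qed

text \<open>The coordinates from \<open>m\<close> on, about which nothing is assumed, vanish
  identically.\<close>

lemma continuous_on_into_Euclidean_space:
  fixes g :: "'a::topological_space \<Rightarrow> nat \<Rightarrow> real"
  assumes "\<And>x. x \<in> U \<Longrightarrow> g x \<in> topspace (Euclidean_space m)"
    and "\<And>j. j < m \<Longrightarrow> continuous_on U (\<lambda>x. g x j)"
  shows "continuous_on U g"
proof (rule continuous_on_coordinatewise_then_product)
  fix i
  show "continuous_on U (\<lambda>x. g x i)"
  proof (cases "i < m")
    case False
    hence "g x i = 0" if "x \<in> U" for x using assms(1)[OF that] by (simp add: mem_Euclidean_space)
    thus ?thesis by (metis (no_types, lifting) continuous_on_cong continuous_on_const)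
  qed (use assms in auto)
qed

text \<open>The chain rule expresses a partial derivative as a sum of products of a derivative of
  \<open>g\<close> with a composition (f' j) o g. The inner map stays the same and only
  \<open>f\<close> changes, so the induction on \<open>k\<close> generalises over \<open>f\<close>
  alone.\<close>

lemma Ck_on_compose:
  fixes f :: "(nat \<Rightarrow> real) \<Rightarrow> 'a::real_normed_vector"
  assumes U: "openin (Euclidean_space n) U" and V: "openin (Euclidean_space m) V"
    and mem: "\<And>x. x \<in> U \<Longrightarrow> g x \<in> V"
  shows "\<lbrakk>\<And>j. j < m \<Longrightarrow> Ck_on k n U (\<lambda>x. g x j); Ck_on k m V f\<rbrakk> \<Longrightarrow> Ck_on k n U (\<lambda>x. f (g x))"
proof (induction k arbitrary: f)
  have cont: "continuous_on U (\<lambda>x. f (g x))"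
    if "\<And>j. j < m \<Longrightarrow> Ck_on k n U (\<lambda>x. g x j)" "Ck_on k m V f" for k and f :: "(nat \<Rightarrow> real) \<Rightarrow> 'a"
    by (rule continuous_on_compose2[OF Ck_on_continuous[OF that(2)]
          continuous_on_into_Euclidean_space[of U g m]])
      (use that mem openin_Euclidean_topspace[OF V] Ck_on_continuous in blast)+
  {
    case 0
    from cont[of 0, OF 0] show ?case by simp
  next
    case (Suc k)
    have gk: "Ck_on k n U (\<lambda>x. g x j)" if "j < m" for j
      using Suc.prems(1)[OF that] by (rule Ck_on_Suc_imp)
    have "\<forall>j. \<exists>d. j < m \<longrightarrow> Ck_on k m V d \<and> (\<forall>x\<in>V. ((\<lambda>t. f (x(j := t))) has_vector_derivative d x) (at (x j)))"
      using Ck_on_SucE[OF Suc.prems(2)] by metis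
    then obtain f' where f': "\<And>j. j < m \<Longrightarrow> Ck_on k m V (f' j)"
      "\<And>j x. j < m \<Longrightarrow> x \<in> V \<Longrightarrow> ((\<lambda>t. f (x(j := t))) has_vector_derivative f' j x) (at (x j))"
      by metis
    show ?case unfolding Ck_on.simps
    proof (intro conjI allI impI)
      show "continuous_on U (\<lambda>x. f (g x))" using cont[of "Suc k", OF Suc.prems] .
      fix i assume i: "i < n"
      have "\<forall>j. \<exists>d. j < m \<longrightarrow> Ck_on k n U d \<and> (\<forall>x\<in>U. ((\<lambda>t. g (x(i := t)) j) has_vector_derivative d x) (at (x i)))"
        using Ck_on_SucE[OF Suc.prems(1) i] by metis
      then obtain g' where g': "\<And>j. j < m \<Longrightarrow> Ck_on k n U (g' j)"
        "\<And>j x. j < m \<Longrightarrow> x \<in> U \<Longrightarrow> ((\<lambda>t. g (x(i := t)) j) has_vector_derivative g' j x) (at (x i))"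
        by metis
      have "((\<lambda>t. f (g (x(i := t)))) has_vector_derivative (\<Sum>j<m. g' j x *\<^sub>R f' j (g x))) (at (x i))"
        if x: "x \<in> U" for x
      proof -
        have "((\<lambda>t. f (g (x(i := t)))) has_vector_derivative
            (\<Sum>j<m. g' j x *\<^sub>R f' j (g (x(i := x i))))) (at (x i))"
        proof (rule chain_rule_curve[OF V open_coordinate_line[OF U x i]])
          show "continuous_on {t. x(i := t) \<in> U} (\<lambda>t. g (x(i := t)) j)" if "j < m" for j
          proof (rule continuous_on_compose2[where f = "\<lambda>t. x(i := t)"])
            show "continuous_on U (\<lambda>x. g x j)"
              using Suc.prems(1)[OF that] by (rule Ck_on_continuous)
            show "continuous_on {t. x(i := t) \<in> U} (\<lambda>t. x(i := t))"
              by (rule continuous_on_fun_upd[OF continuous_on_const continuous_on_id])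
          qed blast
          show "x i \<in> {t. x(i := t) \<in> U}" using x by simp
          show "((\<lambda>t. g (x(i := t)) j) has_vector_derivative g' j x) (at (x i))" if "j < m" for j
            by (rule g'(2)[OF that x])
          show "continuous_on V (f' j)" if "j < m" for j
            using f'(1)[OF that] by (rule Ck_on_continuous)
        qed (use mem f'(2) in blast)+
        thus ?thesis by simp
      qed
      moreover have "Ck_on k n U (\<lambda>x. \<Sum>j<m. g' j x *\<^sub>R f' j (g x))"
        by (intro Ck_on_sum Ck_on_scaleR Suc.IH) (use gk f'(1) g'(1) in blast)+
      ultimately show "\<exists>d. Ck_on k n U d \<and>
          (\<forall>x\<in>U. ((\<lambda>t. f (g (x(i := t)))) has_vector_derivative d x) (at (x i)))" by blast
    qed
  }
qed

text \<open>Leads from the one-variable notion to \<open>Ck_on\<close>: \<open>D\<theta> f\<close>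
  is again \<open>smooth_real\<close>, so the one-variable chain rule reproduces the claim at one
  order less.\<close>

lemma Ck_on_smooth_real:
  assumes f: "smooth_real f" and g: "Ck_on k n U g"
  shows "Ck_on k n U (\<lambda>x. f (g x))"
  using assms
proof (induction k arbitrary: f)
  have cont: "continuous_on U (\<lambda>x. f (g x))" if "smooth_real f" "Ck_on k n U g" for f :: "real \<Rightarrow> 'a" and k
  proof -
    have "f differentiable (at \<theta>)" for \<theta>
      using that(1) unfolding smooth_real_def by (metis funpow_0)
    hence "continuous_on UNIV f"
      by (simp add: continuous_at_imp_continuous_on differentiable_imp_continuous_within)
    thus ?thesis using Ck_on_continuous[OF that(2)] by (rule continuous_on_compose2) simp
  qed
  {
    case 0
    show ?case using cont[OF 0] by simp
  next
    case (Suc k)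
    have f': "smooth_real (D\<theta> f)"
      using Suc.prems(1) unfolding smooth_real_def by (metis funpow_Suc_right o_apply)
    have df: "(f has_vector_derivative D\<theta> f \<theta>) (at \<theta>)" for \<theta>
      using Suc.prems(1) unfolding smooth_real_def D\<theta>_def
      by (metis funpow_0 vector_derivative_works)
    show ?case unfolding Ck_on.simps
    proof (intro conjI allI impI)
      show "continuous_on U (\<lambda>x. f (g x))" by (rule cont[OF Suc.prems])
      fix i assume i: "i < n"
      obtain g' where g': "Ck_on k n U g'"
        "\<And>x. x \<in> U \<Longrightarrow> ((\<lambda>t. g (x(i := t))) has_vector_derivative g' x) (at (x i))"
        using Ck_on_SucE[OF Suc.prems(2) i] by blast
      show "\<exists>d. Ck_on k n U d \<and>
          (\<forall>x\<in>U. ((\<lambda>t. f (g (x(i := t)))) has_vector_derivative d x) (at (x i)))"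
      proof (rule exI[of _ "\<lambda>x. g' x *\<^sub>R D\<theta> f (g x)"], intro conjI ballI)
        show "Ck_on k n U (\<lambda>x. g' x *\<^sub>R D\<theta> f (g x))"
          by (intro Ck_on_scaleR g'(1) Suc.IH f' Ck_on_Suc_imp[OF Suc.prems(2)])
        fix x assume x: "x \<in> U"
        have "(f has_vector_derivative D\<theta> f (g x)) (at (g (x(i := x i))))" using df by simp
        from vector_diff_chain_at[OF g'(2)[OF x] this]
        show "((\<lambda>t. f (g (x(i := t)))) has_vector_derivative g' x *\<^sub>R D\<theta> f (g x)) (at (x i))"
          unfolding o_def .
      qed
    qed
  }
qed

text \<open>Differentiation under the integral sign over a compact interval, the integration
  variable being the extra coordinate \<open>n\<close>. Only partial derivatives with index below
  \<open>n\<close> survive, and each is a parameter integral of the same shape.\<close>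

lemma Ck_on_integral:
  fixes f :: "(nat \<Rightarrow> real) \<Rightarrow> 'b::euclidean_space"
  assumes U: "openin (Euclidean_space n) U"
    and f: "Ck_on k (Suc n) {y \<in> topspace (Euclidean_space (Suc n)). y(n := 0) \<in> U} f"
  shows "Ck_on k n U (\<lambda>x. integral {a..b} (\<lambda>s. f (x(n := s))))"
  using f
proof (induction k arbitrary: f)
  let ?C = "{y \<in> topspace (Euclidean_space (Suc n)). y(n := 0) \<in> U}"
  have mem: "x(n := s) \<in> ?C" if "x \<in> U" for x s
  proof -
    have "\<forall>i\<ge>n. x i = 0" using openin_Euclidean_topspace[OF U that] by (simp add: mem_Euclidean_space)
    hence "x(n := 0) = x" by (auto simp: fun_eq_iff)
    thus ?thesis using that \<open>\<forall>i\<ge>n. x i = 0\<close> by (auto simp: mem_Euclidean_space)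
  qed
  have cont: "continuous_on (S \<times> T) (\<lambda>(x, s). f ((h x)(n := s)))"
    if "continuous_on ?C f" "continuous_on S h" "h ` S \<subseteq> U"
    for f :: "(nat \<Rightarrow> real) \<Rightarrow> 'b" and S :: "'c::topological_space set" and T h
  proof -
    have "continuous_on (S \<times> T) (\<lambda>z. (h (fst z))(n := snd z))"
      by (intro continuous_on_fun_upd continuous_on_snd continuous_on_id
          continuous_on_compose2[OF that(2) continuous_on_fst[OF continuous_on_id]]) auto
    thus ?thesis unfolding split_beta
      by (rule continuous_on_compose2[OF that(1)]) (use mem that(3) in auto)
  qed
  have cont_int: "continuous_on U (\<lambda>x. integral {a..b} (\<lambda>s. f (x(n := s))))"
    if "continuous_on ?C f" for f :: "(nat \<Rightarrow> real) \<Rightarrow> 'b"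
    using integral_continuous_on_param[of U a b "\<lambda>x s. f (x(n := s))"]
      cont[OF that continuous_on_id, of U "{a..b}"] by simp
  {
    case 0
    show ?case unfolding Ck_on.simps by (rule cont_int[OF Ck_on_continuous[OF 0]])
  next
    case (Suc k)
    show ?case unfolding Ck_on.simps
    proof (intro conjI allI impI)
      show "continuous_on U (\<lambda>x. integral {a..b} (\<lambda>s. f (x(n := s))))"
        by (rule cont_int[OF Ck_on_continuous[OF Suc.prems]])
      fix i assume i: "i < n"
      then obtain f' where f': "Ck_on k (Suc n) ?C f'"
        "\<And>y. y \<in> ?C \<Longrightarrow> ((\<lambda>t. f (y(i := t))) has_vector_derivative f' y) (at (y i))"
        using Ck_on_SucE[OF Suc.prems less_SucI[OF i]] by blast
      have "((\<lambda>t. integral {a..b} (\<lambda>s. f (x(i := t, n := s)))) has_vector_derivative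
          integral {a..b} (\<lambda>s. f' (x(n := s)))) (at (x i))" if x: "x \<in> U" for x
      proof -
        obtain e where e: "e > 0" "ball (x i) e \<subseteq> {t. x(i := t) \<in> U}"
          using open_coordinate_line[OF U x i] x open_contains_ball[of "{t. x(i := t) \<in> U}"]
          by (metis fun_upd_triv mem_Collect_eq)
        have ine: "i \<noteq> n" using i by simp
        have line: "continuous_on B (\<lambda>t. x(i := t))" for B
          by (rule continuous_on_fun_upd[OF continuous_on_const continuous_on_id])
        have im: "(\<lambda>t. x(i := t)) ` ball (x i) e \<subseteq> U" using e(2) by blast
        have "((\<lambda>t. integral (cbox a b) (\<lambda>s. f (x(i := t, n := s)))) has_vector_derivative
          integral (cbox a b) (\<lambda>s. f' (x(i := x i, n := s)))) (at (x i) within ball (x i) e)"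
        proof (rule leibniz_rule_vector_derivative)
          fix t s assume t: "t \<in> ball (x i) e"
          have "x(i := t, n := s) \<in> ?C" by (rule mem) (use t im in blast)
          from f'(2)[OF this] ine
          have "((\<lambda>u. f (x(i := u, n := s))) has_vector_derivative f' (x(i := t, n := s))) (at t)"
            by (simp add: fun_upd_twist)
          thus "((\<lambda>u. f (x(i := u, n := s))) has_vector_derivative f' (x(i := t, n := s)))
              (at t within ball (x i) e)"
            by (rule has_vector_derivative_at_within)
        next
          fix t assume t: "t \<in> ball (x i) e"
          have "continuous_on (cbox a b) (\<lambda>s. f (x(i := t, n := s)))"
          proof (rule continuous_on_compose2[OF Ck_on_continuous[OF Suc.prems]])
            show "continuous_on (cbox a b) (\<lambda>s. x(i := t, n := s))"
              by (rule continuous_on_fun_upd[OF continuous_on_const continuous_on_id])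
            show "(\<lambda>s. x(i := t, n := s)) ` cbox a b \<subseteq> ?C" using mem im t by blast
          qed
          thus "(\<lambda>s. f (x(i := t, n := s))) integrable_on cbox a b"
            by (rule integrable_continuous)
        next
          show "continuous_on (ball (x i) e \<times> cbox a b) (\<lambda>(t, s). f' (x(i := t, n := s)))"
            by (rule cont[OF Ck_on_continuous[OF f'(1)] line im])
        qed (use e in auto)
        thus ?thesis using at_within_open[of "x i" "ball (x i) e"] e(1) by simp
      qed
      moreover have "Ck_on k n U (\<lambda>x. integral {a..b} (\<lambda>s. f' (x(n := s))))"
        by (rule Suc.IH[OF f'(1)])
      ultimately show "\<exists>d. Ck_on k n U d \<and>
          (\<forall>x\<in>U. ((\<lambda>t. integral {a..b} (\<lambda>s. f (x(i := t, n := s)))) has_vector_derivative d x) (at (x i)))"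
        by blast
    qed
  }
qed

section \<open>Smooth functions of several real variables\<close>

lemma smooth_on_Rn_open: "smooth_on_Rn n U f \<Longrightarrow> openin (Euclidean_space n) U"
  and smooth_on_Rn_Ck: "smooth_on_Rn n U f \<Longrightarrow> Ck_on k n U f"
  and smooth_on_Rn_continuous: "smooth_on_Rn n U f \<Longrightarrow> continuous_on U f"
  using Ck_on_continuous[of 0] unfolding smooth_on_Rn_def by blast+

lemma smooth_on_Rn_cong:
  assumes "smooth_on_Rn n U f" "\<And>x. x \<in> U \<Longrightarrow> f x = g x"
  shows "smooth_on_Rn n U g"
  unfolding smooth_on_Rn_def
  by (intro conjI allI smooth_on_Rn_open[OF assms(1)]
      Ck_on_cong_imp[OF smooth_on_Rn_open[OF assms(1)] assms(2) smooth_on_Rn_Ck[OF assms(1)]])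

lemma smooth_on_Rn_const: "openin (Euclidean_space n) U \<Longrightarrow> smooth_on_Rn n U (\<lambda>x. c)"
  and smooth_on_Rn_coord: "openin (Euclidean_space n) U \<Longrightarrow> smooth_on_Rn n U (\<lambda>x. x j)"
  unfolding smooth_on_Rn_def using Ck_on_const Ck_on_coord by blast+

lemma smooth_on_Rn_add:
  "smooth_on_Rn n U f \<Longrightarrow> smooth_on_Rn n U g \<Longrightarrow> smooth_on_Rn n U (\<lambda>x. f x + g x)"
  unfolding smooth_on_Rn_def using Ck_on_add by blast

lemma smooth_on_Rn_bilinear:
  "bounded_bilinear B \<Longrightarrow> smooth_on_Rn n U f \<Longrightarrow> smooth_on_Rn n U g \<Longrightarrow>
    smooth_on_Rn n U (\<lambda>x. B (f x) (g x))"
  unfolding smooth_on_Rn_def using Ck_on_bilinear by blast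

lemmas smooth_on_Rn_scaleR = smooth_on_Rn_bilinear[OF bounded_bilinear_scaleR]
lemmas smooth_on_Rn_mult = smooth_on_Rn_bilinear[OF bounded_bilinear_mult]

lemma smooth_on_Rn_diff:
  assumes "smooth_on_Rn n U f" "smooth_on_Rn n U g"
  shows "smooth_on_Rn n U (\<lambda>x. f x - g x)"
  using smooth_on_Rn_add[OF assms(1) smooth_on_Rn_scaleR[OF smooth_on_Rn_const[of n U "-1"] assms(2)]]
    smooth_on_Rn_open[OF assms(1)] by simp

lemma smooth_on_Rn_smooth_real:
  "smooth_real f \<Longrightarrow> smooth_on_Rn n U g \<Longrightarrow> smooth_on_Rn n U (\<lambda>x. f (g x))"
  unfolding smooth_on_Rn_def using Ck_on_smooth_real by blast

lemma smooth_on_Rn_compose: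
  assumes U: "openin (Euclidean_space n) U" and f: "smooth_on_Rn m V f"
    and mem: "\<And>x. x \<in> U \<Longrightarrow> g x \<in> V"
    and g: "\<And>j. j < m \<Longrightarrow> smooth_on_Rn n U (\<lambda>x. g x j)"
  shows "smooth_on_Rn n U (\<lambda>x. f (g x))"
  unfolding smooth_on_Rn_def
proof (intro conjI allI)
  fix k
  show "Ck_on k n U (\<lambda>x. f (g x))"
    by (rule Ck_on_compose[OF U smooth_on_Rn_open[OF f] mem smooth_on_Rn_Ck[OF g] smooth_on_Rn_Ck[OF f]])
qed (rule U)

lemma smooth_on_Rn_integral:
  fixes f :: "(nat \<Rightarrow> real) \<Rightarrow> 'b::euclidean_space"
  assumes "openin (Euclidean_space n) U"
    and "smooth_on_Rn (Suc n) {y \<in> topspace (Euclidean_space (Suc n)). y(n := 0) \<in> U} f"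
  shows "smooth_on_Rn n U (\<lambda>x. integral {a..b} (\<lambda>s. f (x(n := s))))"
  using assms Ck_on_integral[OF assms(1)] unfolding smooth_on_Rn_def by blast

text \<open>For every order \<open>k\<close> the definition offers its own derivative function.
  Uniqueness of derivatives identifies all of them on \<open>U\<close> with
  \<open>vector_derivative\<close>, so a single \<open>g\<close> has every order.\<close>

lemma smooth_on_Rn_partial:
  assumes f: "smooth_on_Rn n U f" and i: "i < n"
  obtains g where "smooth_on_Rn n U g"
    "\<And>x. x \<in> U \<Longrightarrow> ((\<lambda>t. f (x(i := t))) has_vector_derivative g x) (at (x i))"
proof
  let ?g = "\<lambda>x. vector_derivative (\<lambda>t. f (x(i := t))) (at (x i))"
  have "Ck_on k n U ?g \<and> (\<forall>x\<in>U. ((\<lambda>t. f (x(i := t))) has_vector_derivative ?g x) (at (x i)))" for k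
  proof -
    obtain d where d: "Ck_on k n U d"
      "\<And>x. x \<in> U \<Longrightarrow> ((\<lambda>t. f (x(i := t))) has_vector_derivative d x) (at (x i))"
      using Ck_on_SucE[OF smooth_on_Rn_Ck[OF f] i] by blast
    hence eq: "d x = ?g x" if "x \<in> U" for x
      using that vector_derivative_at[OF d(2)[OF that]] by simp
    from Ck_on_cong_imp[OF smooth_on_Rn_open[OF f] this d(1)] d(2) eq show ?thesis by metis
  qed
  thus "smooth_on_Rn n U ?g"
    "\<And>x. x \<in> U \<Longrightarrow> ((\<lambda>t. f (x(i := t))) has_vector_derivative ?g x) (at (x i))"
    using smooth_on_Rn_open[OF f] unfolding smooth_on_Rn_def by blast+
qed

text \<open>The way back from several variables to one: the derivative of the restriction to a
  coordinate line is the restriction of a partial derivative, which is smooth on \<open>U\<close>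
  again.\<close>

lemma smooth_real_line:
  assumes "smooth_on_Rn n U f" "i < n" "\<And>t. x(i := t) \<in> U"
  shows "smooth_real (\<lambda>t. f (x(i := t)))"
proof -
  have "((D\<theta> ^^ k) (\<lambda>t. f (x(i := t)))) differentiable (at \<theta>)" for k \<theta>
    using assms(1)
  proof (induction k arbitrary: f)
    case (0 f)
    obtain g where "\<And>x. x \<in> U \<Longrightarrow> ((\<lambda>t. f (x(i := t))) has_vector_derivative g x) (at (x i))"
      using smooth_on_Rn_partial[OF 0 assms(2)] by blast
    from this[OF assms(3), of \<theta>] have "((\<lambda>t. f (x(i := t))) has_vector_derivative g (x(i := \<theta>))) (at \<theta>)"
      by simp
    thus ?case unfolding funpow_0 by (rule differentiableI_vector)
  next
    case (Suc k f)
    obtain g where g: "smooth_on_Rn n U g"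
      "\<And>x. x \<in> U \<Longrightarrow> ((\<lambda>t. f (x(i := t))) has_vector_derivative g x) (at (x i))"
      using smooth_on_Rn_partial[OF Suc.prems assms(2)] by blast
    have "D\<theta> (\<lambda>t. f (x(i := t))) = (\<lambda>t. g (x(i := t)))"
      unfolding D\<theta>_def using vector_derivative_at[OF g(2)[OF assms(3)]] by (simp add: fun_eq_iff)
    thus ?case using Suc.IH[OF g(1)] by (simp only: funpow_Suc_right o_apply)
  qed
  thus ?thesis unfolding smooth_real_def by blast
qed

text \<open>The mean value theorem is used in \<open>s\<close> for the increment G s (b+h) - G s b,
  and then in \<open>t\<close> for \<open>Gs\<close> at the point found.\<close>

lemma mixed_difference:
  fixes G :: "real \<Rightarrow> real \<Rightarrow> real"
  assumes h: "h > 0"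
    and Gs: "\<And>s t. s \<in> {a..a+h} \<Longrightarrow> t \<in> {b..b+h} \<Longrightarrow> ((\<lambda>s. G s t) has_real_derivative Gs s t) (at s)"
    and Gst: "\<And>s t. s \<in> {a..a+h} \<Longrightarrow> t \<in> {b..b+h} \<Longrightarrow> ((\<lambda>t. Gs s t) has_real_derivative Gst s t) (at t)"
  obtains s t where "s \<in> {a..a+h}" "t \<in> {b..b+h}"
    "G (a+h) (b+h) - G (a+h) b - G a (b+h) + G a b = h\<^sup>2 * Gst s t"
proof -
  have "\<exists>s. a < s \<and> s < a + h \<and> (G (a+h) (b+h) - G (a+h) b) - (G a (b+h) - G a b) =
      (a + h - a) * (Gs s (b+h) - Gs s b)"
    by (rule MVT2) (use h in \<open>auto intro!: DERIV_diff Gs\<close>)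
  then obtain s where s: "a < s" "s < a + h"
    "G (a+h) (b+h) - G (a+h) b - G a (b+h) + G a b = h * (Gs s (b+h) - Gs s b)" by auto
  have "\<exists>t. b < t \<and> t < b + h \<and> Gs s (b+h) - Gs s b = (b + h - b) * Gst s t"
    by (rule MVT2) (use h s in \<open>auto intro!: Gst\<close>)
  then obtain t where "b < t" "t < b + h" "Gs s (b+h) - Gs s b = h * Gst s t" by auto
  thus thesis using that[of s t] s by (simp add: power2_eq_square)
qed

text \<open>Schwarz's theorem: the second difference over a square is symmetric in the two
  variables, so over small squares it produces values of both mixed derivatives that coincide, at
  points close to (a, b).\<close>

lemma mixed_partials_commute:
  fixes G :: "real \<Rightarrow> real \<Rightarrow> real"
  assumes S: "open S" "(a, b) \<in> S"
    and Gs: "\<And>s t. (s, t) \<in> S \<Longrightarrow> ((\<lambda>s. G s t) has_real_derivative Gs s t) (at s)"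
    and Gt: "\<And>s t. (s, t) \<in> S \<Longrightarrow> ((\<lambda>t. G s t) has_real_derivative Gt s t) (at t)"
    and Gst: "\<And>s t. (s, t) \<in> S \<Longrightarrow> ((\<lambda>t. Gs s t) has_real_derivative Gst s t) (at t)"
    and Gts: "\<And>s t. (s, t) \<in> S \<Longrightarrow> ((\<lambda>s. Gt s t) has_real_derivative Gts s t) (at s)"
    and cont: "continuous_on S (\<lambda>(s, t). Gst s t)" "continuous_on S (\<lambda>(s, t). Gts s t)"
  shows "Gst a b = Gts a b"
proof (rule ccontr)
  assume "Gst a b \<noteq> Gts a b"
  \<comment> \<open>Half the gap: two values closer than \<open>d\<close> to its respective ends
    cannot be equal.\<close>
  define d where "d = \<bar>Gst a b - Gts a b\<bar> / 2"
  have d: "d > 0" using \<open>Gst a b \<noteq> Gts a b\<close> by (simp add: d_def)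
  obtain e1 where e1: "e1 > 0" "\<And>z. z \<in> S \<Longrightarrow> dist z (a, b) < e1 \<Longrightarrow> dist (case z of (s, t) \<Rightarrow> Gst s t) (Gst a b) < d"
    using cont(1) S(2) d unfolding continuous_on_iff by fastforce
  obtain e2 where e2: "e2 > 0" "\<And>z. z \<in> S \<Longrightarrow> dist z (a, b) < e2 \<Longrightarrow> dist (case z of (s, t) \<Rightarrow> Gts s t) (Gts a b) < d"
    using cont(2) S(2) d unfolding continuous_on_iff by fastforce
  obtain e3 where e3: "e3 > 0" "ball (a, b) e3 \<subseteq> S" using S open_contains_ball by blast
  \<comment> \<open>Points of the square of side \<open>h\<close> have distance at most 2 h from the
    corner, and 3 h is the least of the three radii.\<close>
  define h where "h = min e1 (min e2 e3) / 3"
  have h: "h > 0" using e1 e2 e3 by (simp add: h_def)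
  have near: "dist (s, t) (a, b) < min e1 (min e2 e3)" if "s \<in> {a..a+h}" "t \<in> {b..b+h}" for s t
  proof -
    have "dist (s, t) (a, b) \<le> \<bar>s - a\<bar> + \<bar>t - b\<bar>"
      unfolding dist_prod_def by (simp add: dist_real_def sqrt_sum_squares_le_sum_abs)
    also have "\<dots> \<le> 2 * h" using that by auto
    also have "\<dots> < 3 * h" using h by simp
    finally show ?thesis by (simp add: h_def)
  qed
  have inS: "(s, t) \<in> S" if "s \<in> {a..a+h}" "t \<in> {b..b+h}" for s t
    using near[OF that] e3(2) by (auto simp: dist_commute)
  obtain s t where st: "s \<in> {a..a+h}" "t \<in> {b..b+h}"
    "G (a+h) (b+h) - G (a+h) b - G a (b+h) + G a b = h\<^sup>2 * Gst s t"
    by (rule mixed_difference[OF h, of a b G Gs Gst]) (use Gs Gst inS in blast)+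
  \<comment> \<open>The same second difference, with the roles of the two variables
    exchanged.\<close>
  obtain t' s' where st': "t' \<in> {b..b+h}" "s' \<in> {a..a+h}"
    "G (a+h) (b+h) - G a (b+h) - G (a+h) b + G a b = h\<^sup>2 * Gts s' t'"
    by (rule mixed_difference[OF h, of b a "\<lambda>t s. G s t" "\<lambda>t s. Gt s t" "\<lambda>t s. Gts s t"])
      (use Gt Gts inS in blast)+
  have "h\<^sup>2 * Gst s t = h\<^sup>2 * Gts s' t'" using st(3) st'(3) by linarith
  hence "Gst s t = Gts s' t'" using h by simp
  moreover have "dist (Gst s t) (Gst a b) < d" using e1(2)[OF inS[OF st(1,2)]] near[OF st(1,2)] by simp
  moreover have "dist (Gts s' t') (Gts a b) < d"
    using e2(2)[OF inS[OF st'(2,1)]] near[OF st'(2,1)] by simp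
  ultimately have "\<bar>Gst a b - Gts a b\<bar> < 2 * d" by (simp add: dist_real_def)
  thus False by (simp add: d_def)
qed

section \<open>Smooth families of functions on the circle\<close>

text \<open>All spaces R^n live in the single type \<open>nat \<Rightarrow> real\<close>, so a point
  of R^n is also the point of R^(n+1) with last coordinate 0. The equation recovers the parameter
  from a point of the cylinder over \<open>U\<close>.\<close>

lemma fun_upd_last_mem:
  assumes "x \<in> topspace (Euclidean_space n)"
  shows "x(n := t) \<in> topspace (Euclidean_space (Suc n))" "x(n := 0) = x"
  using assms by (auto simp: mem_Euclidean_space fun_eq_iff)

lemma fun_upd_zero_mem:
  assumes "y \<in> topspace (Euclidean_space (Suc n))"
  shows "y(n := 0) \<in> topspace (Euclidean_space n)"
  using assms by (auto simp: mem_Euclidean_space)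

lemma openin_cylinder:
  assumes "openin (Euclidean_space n) U"
  shows "openin (Euclidean_space (Suc n)) {y \<in> topspace (Euclidean_space (Suc n)). y(n := 0) \<in> U}"
  by (rule openin_Euclidean_preimage[OF assms openin_topspace
        continuous_on_fun_upd[OF continuous_on_id continuous_on_const] fun_upd_zero_mem])

lemma mem_cylinder:
  assumes "openin (Euclidean_space n) U" "x \<in> U"
  shows "x(n := t) \<in> {y \<in> topspace (Euclidean_space (Suc n)). y(n := 0) \<in> U}"
  using fun_upd_last_mem[OF openin_Euclidean_topspace[OF assms]] assms(2) by simp

lemma smooth_on_Rn_cylinder:
  assumes "smooth_on_Rn n U f"
  shows "smooth_on_Rn (Suc n) {y \<in> topspace (Euclidean_space (Suc n)). y(n := 0) \<in> U}
    (\<lambda>y. f (y(n := 0)))"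
proof (rule smooth_on_Rn_compose[OF openin_cylinder[OF smooth_on_Rn_open[OF assms]] assms])
  show "smooth_on_Rn (Suc n) {y \<in> topspace (Euclidean_space (Suc n)). y(n := 0) \<in> U}
      (\<lambda>y. (y(n := 0)) j)" if "j < n" for j
    using smooth_on_Rn_coord[OF openin_cylinder[OF smooth_on_Rn_open[OF assms]], of j] that by simp
qed blast

section \<open>Operations on smooth families\<close>

lemma smooth_family_open: "smooth_family n U c \<Longrightarrow> openin (Euclidean_space n) U"
  and smooth_family_periodic: "smooth_family n U c \<Longrightarrow> x \<in> U \<Longrightarrow> periodic (c x)"
  and smooth_family_smooth: "smooth_family n U c \<Longrightarrow>
    smooth_on_Rn (Suc n) {y \<in> topspace (Euclidean_space (Suc n)). y(n := 0) \<in> U} (\<lambda>y. c (y(n := 0)) (y n))"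
  unfolding smooth_family_def by blast+

lemma smooth_familyI:
  assumes "openin (Euclidean_space n) U" "\<And>x. x \<in> U \<Longrightarrow> periodic (c x)"
    and "smooth_on_Rn (Suc n) {y \<in> topspace (Euclidean_space (Suc n)). y(n := 0) \<in> U}
      (\<lambda>y. c (y(n := 0)) (y n))"
  shows "smooth_family n U c"
  using assms unfolding smooth_family_def by blast

lemma smooth_family_bilinear:
  assumes B: "bounded_bilinear B" and c: "smooth_family n U c" and d: "smooth_family n U d"
  shows "smooth_family n U (\<lambda>x \<theta>. B (c x \<theta>) (d x \<theta>))"
proof (rule smooth_familyI[OF smooth_family_open[OF c]])
  show "periodic (\<lambda>\<theta>. B (c x \<theta>) (d x \<theta>))" if "x \<in> U" for x
    using smooth_family_periodic[OF c that] smooth_family_periodic[OF d that] by (simp add: periodic_def)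
qed (rule smooth_on_Rn_bilinear[OF B smooth_family_smooth[OF c] smooth_family_smooth[OF d]])

lemma smooth_family_add:
  assumes c: "smooth_family n U c" and d: "smooth_family n U d"
  shows "smooth_family n U (\<lambda>x \<theta>. c x \<theta> + d x \<theta>)"
proof (rule smooth_familyI[OF smooth_family_open[OF c]])
  show "periodic (\<lambda>\<theta>. c x \<theta> + d x \<theta>)" if "x \<in> U" for x
    using smooth_family_periodic[OF c that] smooth_family_periodic[OF d that] by (simp add: periodic_def)
qed (rule smooth_on_Rn_add[OF smooth_family_smooth[OF c] smooth_family_smooth[OF d]])

lemma smooth_family_param:
  assumes "smooth_on_Rn n U f"
  shows "smooth_family n U (\<lambda>x \<theta>. f x)"
  by (rule smooth_familyI[OF smooth_on_Rn_open[OF assms] _ smooth_on_Rn_cylinder[OF assms]])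
    (simp add: periodic_def)

lemma smooth_family_scaleR:
  assumes "smooth_on_Rn n U f" "smooth_family n U c"
  shows "smooth_family n U (\<lambda>x \<theta>. f x *\<^sub>R c x \<theta>)"
  by (rule smooth_family_bilinear[OF bounded_bilinear_scaleR smooth_family_param[OF assms(1)] assms(2)])

text \<open>Chain rule for the map that acts as \<open>g\<close> on the parameters and as the
  identity on the angle; the angle moves from index \<open>n\<close> to index
  \<open>m\<close>.\<close>

lemma smooth_family_reparam:
  assumes c: "smooth_family m V c" and U: "openin (Euclidean_space n) U"
    and mem: "\<And>x. x \<in> U \<Longrightarrow> g x \<in> V"
    and g: "\<And>j. j < m \<Longrightarrow> smooth_on_Rn n U (\<lambda>x. g x j)"
  shows "smooth_family n U (\<lambda>x. c (g x))"
proof (rule smooth_familyI[OF U])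
  show "periodic (c (g x))" if "x \<in> U" for x using smooth_family_periodic[OF c mem[OF that]] .
  let ?C = "{y \<in> topspace (Euclidean_space (Suc n)). y(n := 0) \<in> U}"
  let ?G = "\<lambda>y. (g (y(n := 0)))(m := y n)"
  have V: "openin (Euclidean_space m) V" by (rule smooth_family_open[OF c])
  have z: "(?G y)(m := 0) = g (y(n := 0))" if "y \<in> ?C" for y
    using fun_upd_last_mem(2)[OF openin_Euclidean_topspace[OF V mem]] that by simp
  have "smooth_on_Rn (Suc n) ?C (\<lambda>y. (\<lambda>y. c (y(m := 0)) (y m)) (?G y))"
  proof (rule smooth_on_Rn_compose[OF openin_cylinder[OF U] smooth_family_smooth[OF c]])
    show "?G y \<in> {y \<in> topspace (Euclidean_space (Suc m)). y(m := 0) \<in> V}" if "y \<in> ?C" for y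
      by (rule mem_cylinder[OF V mem]) (use that in blast)
    fix j assume "j < Suc m"
    show "smooth_on_Rn (Suc n) ?C (\<lambda>y. ?G y j)"
    proof (cases "j = m")
      case True
      thus ?thesis using smooth_on_Rn_coord[OF openin_cylinder[OF U], of n] by simp
    next
      case False
      with \<open>j < Suc m\<close> have "j < m" by simp
      from smooth_on_Rn_cylinder[OF g[OF this]] show ?thesis using False by simp
    qed
  qed
  thus "smooth_on_Rn (Suc n) ?C (\<lambda>y. c (g (y(n := 0))) (y n))"
    by (rule smooth_on_Rn_cong) (use z in simp)
qed

lemma smooth_family_subset:
  assumes "smooth_family n V c" "U \<subseteq> V" "openin (Euclidean_space n) U"
  shows "smooth_family n U c"
  by (rule smooth_family_reparam[OF assms(1,3)]) (use assms smooth_on_Rn_coord in blast)+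

lemma smooth_family_const:
  assumes "f \<in> C_inf" "openin (Euclidean_space n) U"
  shows "smooth_family n U (\<lambda>x. f)"
  by (rule smooth_familyI[OF assms(2) _ smooth_on_Rn_smooth_real[OF _ smooth_on_Rn_coord[OF openin_cylinder[OF assms(2)]]]])
    (use assms(1) in \<open>simp_all add: C_inf_def\<close>)

lemma smooth_family_C_inf:
  assumes c: "smooth_family n U c" and x: "x \<in> U"
  shows "c x \<in> C_inf"
proof -
  have U: "openin (Euclidean_space n) U" by (rule smooth_family_open[OF c])
  have "smooth_real (\<lambda>t. (\<lambda>y. c (y(n := 0)) (y n)) (x(n := t)))"
    by (rule smooth_real_line[OF smooth_family_smooth[OF c] _ mem_cylinder[OF U x]]) simp
  hence "smooth_real (c x)" using fun_upd_last_mem(2)[OF openin_Euclidean_topspace[OF U x]] by simp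
  thus ?thesis using smooth_family_periodic[OF c x] by (simp add: C_inf_def)
qed

lemma openin_Euclidean_space_0: "openin (Euclidean_space 0) {\<lambda>_. 0}"
proof -
  have "topspace (Euclidean_space 0) = {\<lambda>_. 0}" by (auto simp: topspace_Euclidean_space)
  thus ?thesis using openin_topspace[of "Euclidean_space 0"] by simp
qed

text \<open>Over the one-point space R^0 a smooth family is a single function, so closure properties
  of families specialise to closure properties of \<open>C_inf\<close>.\<close>

lemma C_inf_iff_smooth_family: "f \<in> C_inf \<longleftrightarrow> smooth_family 0 {\<lambda>_. 0} (\<lambda>_. f)"
  using smooth_family_const[OF _ openin_Euclidean_space_0] smooth_family_C_inf by blast

lemma C_inf_periodic: "f \<in> C_inf \<Longrightarrow> f (\<theta> + 2 * pi) = f \<theta>"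
  by (simp add: C_inf_def periodic_def)

lemma smooth_real_has_derivative:
  "smooth_real f \<Longrightarrow> (f has_vector_derivative D\<theta> f \<theta>) (at \<theta>)"
  unfolding smooth_real_def D\<theta>_def by (metis funpow_0 vector_derivative_works)

lemma C_inf_has_derivative:
  "f \<in> C_inf \<Longrightarrow> (f has_vector_derivative D\<theta> f \<theta>) (at \<theta>)"
  by (rule smooth_real_has_derivative) (simp add: C_inf_def)

lemma C_inf_continuous: "f \<in> C_inf \<Longrightarrow> continuous_on S f"
  using C_inf_has_derivative has_vector_derivative_continuous
  by (metis continuous_at_imp_continuous_on)

lemma D\<theta>_eqI: "(f has_vector_derivative d) (at \<theta>) \<Longrightarrow> D\<theta> f \<theta> = d"
  by (simp add: D\<theta>_def vector_derivative_at)

lemma periodic_D\<theta>: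
  assumes "f \<in> C_inf"
  shows "periodic (D\<theta> f)"
  unfolding periodic_def
proof
  fix \<theta>
  have "((\<lambda>t. t + 2 * pi) has_vector_derivative 1) (at \<theta>)"
    by (auto intro!: derivative_eq_intros)
  from vector_diff_chain_at[OF this C_inf_has_derivative[OF assms]]
  have "((\<lambda>t. f (t + 2 * pi)) has_vector_derivative D\<theta> f (\<theta> + 2 * pi)) (at \<theta>)"
    by (simp add: o_def)
  hence "(f has_vector_derivative D\<theta> f (\<theta> + 2 * pi)) (at \<theta>)" using C_inf_periodic[OF assms] by simp
  thus "D\<theta> f (\<theta> + 2 * pi) = D\<theta> f \<theta>" by (rule D\<theta>_eqI[symmetric])
qed

text \<open>The angle is the coordinate \<open>n\<close> of the cylinder, so
  \<open>D\<theta>\<close> is one more partial derivative of a smooth function.\<close>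

lemma smooth_family_D\<theta>:
  assumes c: "smooth_family n U c"
  shows "smooth_family n U (\<lambda>x. D\<theta> (c x))"
proof (rule smooth_familyI[OF smooth_family_open[OF c]])
  show "periodic (D\<theta> (c x))" if "x \<in> U" for x
    by (rule periodic_D\<theta>[OF smooth_family_C_inf[OF c that]])
  let ?C = "{y \<in> topspace (Euclidean_space (Suc n)). y(n := 0) \<in> U}"
  obtain g where g: "smooth_on_Rn (Suc n) ?C g"
    "\<And>y. y \<in> ?C \<Longrightarrow> ((\<lambda>t. (\<lambda>y. c (y(n := 0)) (y n)) (y(n := t))) has_vector_derivative g y) (at (y n))"
    using smooth_on_Rn_partial[OF smooth_family_smooth[OF c] lessI] by blast
  have "g y = D\<theta> (c (y(n := 0))) (y n)" if "y \<in> ?C" for y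
    by (rule D\<theta>_eqI[symmetric]) (use g(2)[OF that] in simp)
  from smooth_on_Rn_cong[OF g(1) this]
  show "smooth_on_Rn (Suc n) ?C (\<lambda>y. D\<theta> (c (y(n := 0))) (y n))" .
qed

lemma C_inf_add: "f \<in> C_inf \<Longrightarrow> g \<in> C_inf \<Longrightarrow> (\<lambda>\<theta>. f \<theta> + g \<theta>) \<in> C_inf"
  unfolding C_inf_iff_smooth_family by (rule smooth_family_add)

lemma C_inf_bilinear:
  "bounded_bilinear B \<Longrightarrow> f \<in> C_inf \<Longrightarrow> g \<in> C_inf \<Longrightarrow> (\<lambda>\<theta>. B (f \<theta>) (g \<theta>)) \<in> C_inf"
  unfolding C_inf_iff_smooth_family by (rule smooth_family_bilinear)

lemma C_inf_D\<theta>: "f \<in> C_inf \<Longrightarrow> D\<theta> f \<in> C_inf"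
  unfolding C_inf_iff_smooth_family by (rule smooth_family_D\<theta>)

lemma C_inf_const: "(\<lambda>_. v) \<in> C_inf"
  unfolding C_inf_iff_smooth_family
  by (rule smooth_family_param[OF smooth_on_Rn_const[OF openin_Euclidean_space_0]])

lemma C_inf_scaleR: "f \<in> C_inf \<Longrightarrow> (\<lambda>\<theta>. r *\<^sub>R f \<theta>) \<in> C_inf"
  by (rule C_inf_bilinear[OF bounded_bilinear_scaleR C_inf_const])

lemma vertical_C_inf: "c \<in> C_inf \<Longrightarrow> a \<in> C_inf \<Longrightarrow> vertical c a \<in> C_inf"
  unfolding vertical_def by (rule C_inf_bilinear[OF bounded_bilinear_scaleR _ C_inf_D\<theta>])

text \<open>A detour through functions on R^1: iterated derivatives of a composition are handled by
  the C^k calculus instead of an explicit formula.\<close>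

lemma smooth_real_compose:
  assumes "smooth_real f" "smooth_real g"
  shows "smooth_real (f \<circ> g)"
proof -
  have "smooth_on_Rn 1 (topspace (Euclidean_space 1)) (\<lambda>x. f (g (x 0)))"
    by (rule smooth_on_Rn_smooth_real[OF assms(1) smooth_on_Rn_smooth_real[OF assms(2)
            smooth_on_Rn_coord[OF openin_topspace]]])
  from smooth_real_line[OF this, of 0 "\<lambda>_. 0"] show ?thesis
    by (simp add: o_def mem_Euclidean_space)
qed

lemma smooth_family_integral:
  fixes f :: "(nat \<Rightarrow> real) \<Rightarrow> real \<Rightarrow> 'b::euclidean_space"
  assumes f: "smooth_family n U f"
  shows "smooth_on_Rn n U (\<lambda>x. integral {a..b} (f x))"
proof (rule smooth_on_Rn_cong[OF smooth_on_Rn_integral[OF smooth_family_open[OF f] smooth_family_smooth[OF f]]])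
  fix x assume "x \<in> U"
  thus "integral {a..b} (\<lambda>s. f (x(n := s, n := 0)) ((x(n := s)) n)) = integral {a..b} (f x)"
    using fun_upd_last_mem(2)[OF openin_Euclidean_topspace[OF smooth_family_open[OF f]]] by simp
qed

text \<open>Brings the compactness of one period to bear on statements about all real
  angles.\<close>

lemma periodic_representative:
  assumes "periodic f"
  shows "\<exists>\<theta>'\<in>{0..2*pi}. f \<theta>' = f \<theta>"
proof -
  interpret periodic_fun_simple f "2 * pi"
    by standard (use assms in \<open>simp add: periodic_def\<close>)
  let ?k = "\<lfloor>\<theta> / (2 * pi)\<rfloor>"
  have "of_int ?k * (2 * pi) \<le> \<theta>" "\<theta> < (of_int ?k + 1) * (2 * pi)"
    using floor_divide_lower[of "2 * pi" \<theta>] floor_divide_upper[of "2 * pi" \<theta>] by simp_all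
  hence "\<theta> - of_int ?k * (2 * pi) \<in> {0..2*pi}" by (simp add: algebra_simps)
  thus ?thesis using minus_of_int by blast
qed

text \<open>Openness of \<open>Imm\<close> as seen by families. The derivative is jointly continuous
  and nonzero on {x} x [0, 2 pi]; by the tube lemma it stays nonzero for nearby parameters over one
  period, hence by periodicity over the whole line.\<close>

lemma openin_Imm_family:
  assumes c: "smooth_family n U c"
  shows "openin (Euclidean_space n) {x \<in> U. c x \<in> Imm}"
proof -
  have U: "openin (Euclidean_space n) U" by (rule smooth_family_open[OF c])
  note dc = smooth_family_D\<theta>[OF c]
  have "continuous_on (U \<times> UNIV) (\<lambda>z. (\<lambda>y. D\<theta> (c (y(n := 0))) (y n)) ((fst z)(n := snd z)))"
  proof (rule continuous_on_compose2[OF smooth_on_Rn_continuous[OF smooth_family_smooth[OF dc]]])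
    show "continuous_on (U \<times> UNIV) (\<lambda>z. (fst z)(n := snd z))"
      by (intro continuous_on_fun_upd continuous_on_fst continuous_on_snd continuous_on_id)
    show "(\<lambda>z. (fst z)(n := snd z)) ` (U \<times> UNIV)
        \<subseteq> {y \<in> topspace (Euclidean_space (Suc n)). y(n := 0) \<in> U}"
      using mem_cylinder[OF U] by auto
  qed
  then obtain A where A: "open A" "A \<inter> (U \<times> UNIV) =
      (\<lambda>z. (\<lambda>y. D\<theta> (c (y(n := 0))) (y n)) ((fst z)(n := snd z))) -` (- {0}) \<inter> (U \<times> UNIV)"
    unfolding continuous_on_open_invariant by (meson open_Compl closed_singleton)
  have A_iff: "(x, t) \<in> A \<longleftrightarrow> D\<theta> (c x) t \<noteq> 0" if "x \<in> U" for x t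
  proof -
    have "x(n := 0) = x" by (rule fun_upd_last_mem(2)[OF openin_Euclidean_topspace[OF U that]])
    moreover have "(x, t) \<in> A \<longleftrightarrow> (x, t) \<in> A \<inter> (U \<times> UNIV)" using that by simp
    ultimately show ?thesis unfolding A(2) using that by simp
  qed
  have "\<exists>T. openin (Euclidean_space n) T \<and> x \<in> T \<and> T \<subseteq> {x \<in> U. c x \<in> Imm}"
    if x: "x \<in> U" "c x \<in> Imm" for x
  proof -
    have "{x} \<times> {0..2*pi} \<subseteq> A" using x A_iff[OF x(1)] by (auto simp: Imm_def)
    from Elementary_Topology.tube_lemma[OF compact_Icc A(1) this]
    obtain X where X: "x \<in> X" "open X" "X \<times> {0..2*pi} \<subseteq> A" by (elim exE conjE)
    have "c z \<in> Imm" if z: "z \<in> X" "z \<in> U" for z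
    proof -
      have "D\<theta> (c z) \<theta> \<noteq> 0" for \<theta>
      proof -
        obtain \<theta>' where \<theta>': "\<theta>' \<in> {0..2*pi}" "D\<theta> (c z) \<theta>' = D\<theta> (c z) \<theta>"
          using periodic_representative[OF smooth_family_periodic[OF dc z(2)]] by blast
        hence "(z, \<theta>') \<in> A" using X(3) z by blast
        thus ?thesis using A_iff[OF z(2), of \<theta>'] \<theta>'(2) by simp
      qed
      thus ?thesis using smooth_family_C_inf[OF c z(2)] by (simp add: Imm_def)
    qed
    moreover have "openin (Euclidean_space n) (U \<inter> X)"
    proof -
      obtain T where "open T" "U = T \<inter> topspace (Euclidean_space n)"
        using U unfolding openin_Euclidean_space_iff by blast
      hence "U \<inter> X = (T \<inter> X) \<inter> topspace (Euclidean_space n)" "open (T \<inter> X)" using X by auto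
      thus ?thesis unfolding openin_Euclidean_space_iff by blast
    qed
    ultimately show ?thesis using X(1) x(1) by (intro exI[of _ "U \<inter> X"]) auto
  qed
  thus ?thesis by (subst openin_subopen) blast
qed

text \<open>The source of the nonconstant families of immersions used below: a variation is written
  down in the full function space, and its parameter domain is then cut down.\<close>

lemma smooth_family_Imm_restrict:
  assumes "smooth_family n U c"
  shows "Imm_family n {x \<in> U. c x \<in> Imm} c"
  unfolding Imm_family_def
  using smooth_family_subset[OF assms _ openin_Imm_family[OF assms]] by blast

section \<open>Reparametrisations\<close>

lemma Diff_plus_period: "\<phi> \<in> Diff_plus \<Longrightarrow> \<phi> (2 * pi) = \<phi> 0 + 2 * pi"
  unfolding Diff_plus_def by (metis (mono_tags, lifting) add_0 mem_Collect_eq)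

lemma Diff_plus_has_derivative:
  "\<phi> \<in> Diff_plus \<Longrightarrow> (\<phi> has_vector_derivative D\<theta> \<phi> \<theta>) (at \<theta>)"
  by (rule smooth_real_has_derivative) (simp add: Diff_plus_def)

lemma C_inf_comp_Diff:
  assumes "f \<in> C_inf" "\<phi> \<in> Diff_plus"
  shows "f \<circ> \<phi> \<in> C_inf"
  using assms smooth_real_compose[of f \<phi>] by (auto simp: C_inf_def Diff_plus_def periodic_def)

lemma D\<theta>_comp_Diff:
  assumes "f \<in> C_inf" "\<phi> \<in> Diff_plus"
  shows "D\<theta> (f \<circ> \<phi>) \<theta> = D\<theta> \<phi> \<theta> *\<^sub>R D\<theta> f (\<phi> \<theta>)"
  by (rule D\<theta>_eqI[OF vector_diff_chain_at[OF Diff_plus_has_derivative[OF assms(2)]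
          C_inf_has_derivative[OF assms(1)]]])

lemma Imm_comp_Diff:
  assumes "c \<in> Imm" "\<phi> \<in> Diff_plus"
  shows "c \<circ> \<phi> \<in> Imm"
proof -
  have c: "c \<in> C_inf" using assms(1) by (simp add: Imm_def)
  have "D\<theta> \<phi> \<theta> > 0" for \<theta> using assms(2) by (simp add: Diff_plus_def)
  hence "D\<theta> (c \<circ> \<phi>) \<theta> \<noteq> 0" for \<theta>
    using assms(1) by (simp add: D\<theta>_comp_Diff[OF c assms(2)] Imm_def) (metis less_irrefl)
  thus ?thesis using C_inf_comp_Diff[OF c assms(2)] by (simp add: Imm_def)
qed

text \<open>With an antiderivative \<open>F\<close> of \<open>f\<close>, both sides are values of the function
  \<open>F (x + 2\<pi>) - F x\<close>, which is constant as \<open>f\<close> is periodic.\<close>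

lemma integral_Diff_plus:
  fixes f :: "real \<Rightarrow> real"
  assumes f: "f \<in> C_inf" and \<phi>: "\<phi> \<in> Diff_plus"
  shows "integral {0..2*pi} (\<lambda>\<theta>. D\<theta> \<phi> \<theta> * f (\<phi> \<theta>)) = integral {0..2*pi} f"
proof -
  \<comment> \<open>The antiderivative is wanted on the whole line, since \<phi> may carry [0, 2 pi]
    outside itself.\<close>
  have "\<exists>F. \<forall>x. -\<infinity> < ereal x \<longrightarrow> ereal x < \<infinity> \<longrightarrow> (F has_vector_derivative f x) (at x)"
    by (rule einterval_antiderivative)
      (use C_inf_has_derivative[OF f] in \<open>auto intro: has_vector_derivative_continuous\<close>)
  then obtain F where F: "\<And>x. (F has_vector_derivative f x) (at x)" by auto
  have "((\<lambda>x. F (x + 2 * pi) - F x) has_vector_derivative 0) (at x)" for x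
  proof -
    have "((\<lambda>t. t + 2 * pi) has_vector_derivative 1) (at x)"
      by (auto intro!: derivative_eq_intros)
    from vector_diff_chain_at[OF this F]
    have "((\<lambda>t. F (t + 2 * pi)) has_vector_derivative f x) (at x)"
      using C_inf_periodic[OF f] by (simp add: o_def)
    from has_vector_derivative_diff[OF this F] show ?thesis by simp
  qed
  hence const: "F (x + 2 * pi) - F x = F (0 + 2 * pi) - F 0" for x
    by (intro DERIV_isconst_all[of "\<lambda>x. F (x + 2 * pi) - F x"])
      (simp add: has_real_derivative_iff_has_vector_derivative)
  have "(f has_integral F (2 * pi) - F 0) {0..2*pi}"
    by (rule fundamental_theorem_of_calculus) (use F in \<open>auto intro: has_vector_derivative_at_within\<close>)
  moreover have "((\<lambda>\<theta>. D\<theta> \<phi> \<theta> * f (\<phi> \<theta>)) has_integral F (\<phi> (2 * pi)) - F (\<phi> 0)) {0..2*pi}"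
  proof (rule fundamental_theorem_of_calculus)
    fix x
    from vector_diff_chain_at[OF Diff_plus_has_derivative[OF \<phi>] F, of x]
    have "((\<lambda>t. F (\<phi> t)) has_vector_derivative D\<theta> \<phi> x * f (\<phi> x)) (at x)"
      by (simp add: o_def)
    thus "((\<lambda>t. F (\<phi> t)) has_vector_derivative D\<theta> \<phi> x * f (\<phi> x)) (at x within {0..2*pi})"
      by (rule has_vector_derivative_at_within)
  qed simp
  ultimately show ?thesis
    using const[of "\<phi> 0"] Diff_plus_period[OF \<phi>] by (simp add: integral_unique)
qed

section \<open>Directional derivatives of one-forms\<close>

text \<open>Point and vector vary together. Linearity is a separate predicate, so that a first
  directional derivative of a form can re-enter as a \<open>smooth_form\<close>.\<close>

definition smooth_form :: "(curve \<Rightarrow> curve \<Rightarrow> real) \<Rightarrow> bool"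
  where "smooth_form F \<longleftrightarrow> (\<forall>n U c h. Imm_family n U c \<longrightarrow> smooth_family n U h \<longrightarrow>
    smooth_on_Rn n U (\<lambda>x. F (c x) (h x)))"

lemma smooth_formD:
  "smooth_form F \<Longrightarrow> Imm_family n U c \<Longrightarrow> smooth_family n U h \<Longrightarrow>
    smooth_on_Rn n U (\<lambda>x. F (c x) (h x))"
  unfolding smooth_form_def by blast

lemma dir_deriv_eqI:
  "((\<lambda>t. F (\<lambda>\<theta>. c \<theta> + t *\<^sub>R h \<theta>)) has_real_derivative d) (at 0) \<Longrightarrow> dir_deriv h F c = d"
  unfolding dir_deriv_def by (rule DERIV_imp_deriv)

text \<open>The time of the variation becomes a new parameter of index \<open>n\<close>. The form
  along the varied curves is smooth on the open set \<open>W\<close> where these are immersed, and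
  the directional derivative is its partial derivative in the new coordinate, restricted to time
  0.\<close>

lemma
  assumes F: "smooth_form F" and c: "Imm_family n U c"
    and h: "smooth_family n U h" and k: "smooth_family n U k"
  shows smooth_dir_deriv: "smooth_on_Rn n U (\<lambda>x. dir_deriv (h x) (\<lambda>c. F c (k x)) (c x))"
    and dir_deriv_family: "x \<in> U \<Longrightarrow> ((\<lambda>t. F (\<lambda>\<theta>. c x \<theta> + t *\<^sub>R h x \<theta>) (k x))
      has_real_derivative dir_deriv (h x) (\<lambda>c. F c (k x)) (c x)) (at 0)"
proof -
  let ?V = "{y \<in> topspace (Euclidean_space (Suc n)). y(n := 0) \<in> U}"
  have U: "openin (Euclidean_space n) U" by (rule smooth_family_open[OF h])
  have V: "openin (Euclidean_space (Suc n)) ?V" by (rule openin_cylinder[OF U])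
  have lift: "smooth_family (Suc n) ?V (\<lambda>y. f (y(n := 0)))" if "smooth_family n U f" for f :: "(nat \<Rightarrow> real) \<Rightarrow> curve"
  proof (rule smooth_family_reparam[OF that V])
    show "smooth_on_Rn (Suc n) ?V (\<lambda>y. (y(n := 0)) j)" if "j < n" for j
      using smooth_on_Rn_coord[OF V, of j] that by simp
  qed blast
  define C where "C = (\<lambda>y \<theta>. c (y(n := 0)) \<theta> + y n *\<^sub>R h (y(n := 0)) \<theta>)"
  define W where "W = {y \<in> ?V. C y \<in> Imm}"
  have cI: "c x \<in> Imm" if "x \<in> U" for x
    using c that unfolding Imm_family_def by blast
  have c': "smooth_family n U c" using c unfolding Imm_family_def by blast
  have C: "smooth_family (Suc n) ?V C" unfolding C_def
    by (rule smooth_family_add[OF lift[OF c'] smooth_family_scaleR[OF smooth_on_Rn_coord[OF V] lift[OF h]]])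
  have CI: "Imm_family (Suc n) W C" unfolding W_def by (rule smooth_family_Imm_restrict[OF C])
  have W: "openin (Euclidean_space (Suc n)) W" unfolding W_def by (rule openin_Imm_family[OF C])
  define A where "A = (\<lambda>y. F (C y) (k (y(n := 0))))"
  have A: "smooth_on_Rn (Suc n) W A" unfolding A_def
    by (rule smooth_formD[OF F CI smooth_family_subset[OF lift[OF k] _ W]]) (auto simp: W_def)
  obtain g where g: "smooth_on_Rn (Suc n) W g"
    "\<And>y. y \<in> W \<Longrightarrow> ((\<lambda>t. A (y(n := t))) has_vector_derivative g y) (at (y n))"
    using smooth_on_Rn_partial[OF A lessI] by blast
  \<comment> \<open>A parameter \<open>x\<close>, read as a point of R^(n+1), is itself the point of
    \<open>W\<close> at time 0.\<close>
  have x0: "x n = 0" "x(n := 0) = x" "x \<in> W" if "x \<in> U" for x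
  proof -
    have top: "x \<in> topspace (Euclidean_space n)" by (rule openin_Euclidean_topspace[OF U that])
    show "x n = 0" using top by (simp add: mem_Euclidean_space)
    show eq: "x(n := 0) = x" by (rule fun_upd_last_mem(2)[OF top])
    have "x \<in> ?V" using mem_cylinder[OF U that, of 0] unfolding eq .
    moreover have "C x = c x" unfolding C_def eq using \<open>x n = 0\<close> by simp
    ultimately show "x \<in> W" using cI[OF that] unfolding W_def by simp
  qed
  have der: "((\<lambda>t. F (\<lambda>\<theta>. c x \<theta> + t *\<^sub>R h x \<theta>) (k x)) has_real_derivative g x) (at 0)"
    if "x \<in> U" for x
    using g(2)[OF x0(3)[OF that]]
    unfolding A_def C_def fun_upd_upd x0(1,2)[OF that] fun_upd_same
    by (simp add: has_real_derivative_iff_has_vector_derivative)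
  have eq: "g x = dir_deriv (h x) (\<lambda>c. F c (k x)) (c x)" if "x \<in> U" for x
    by (rule dir_deriv_eqI[symmetric, OF der[OF that]])
  show "smooth_on_Rn n U (\<lambda>x. dir_deriv (h x) (\<lambda>c. F c (k x)) (c x))"
  proof (rule smooth_on_Rn_cong[OF _ eq])
    show "smooth_on_Rn n U g"
      by (rule smooth_on_Rn_compose[OF U g(1), of "\<lambda>x. x"]) (rule x0(3) smooth_on_Rn_coord[OF U], assumption?)+
  qed
  show "((\<lambda>t. F (\<lambda>\<theta>. c x \<theta> + t *\<^sub>R h x \<theta>) (k x))
      has_real_derivative dir_deriv (h x) (\<lambda>c. F c (k x)) (c x)) (at 0)" if "x \<in> U"
    using der[OF that] eq[OF that] by simp
qed

lemma Imm_C_inf: "c \<in> Imm \<Longrightarrow> c \<in> C_inf"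
  by (simp add: Imm_def)

lemma Imm_family_const: "c \<in> Imm \<Longrightarrow> openin (Euclidean_space n) U \<Longrightarrow> Imm_family n U (\<lambda>_. c)"
  unfolding Imm_family_def using smooth_family_const Imm_C_inf by blast

text \<open>\<open>dir_deriv\<close> is a total operation; the differentiability that gives it
  meaning comes from the case of constant families over a point.\<close>

lemma dir_deriv_works:
  assumes "smooth_form F" "c \<in> Imm" "h \<in> C_inf" "k \<in> C_inf"
  shows "((\<lambda>t. F (\<lambda>\<theta>. c \<theta> + t *\<^sub>R h \<theta>) k) has_real_derivative dir_deriv h (\<lambda>c. F c k) c) (at 0)"
  using dir_deriv_family[OF assms(1) Imm_family_const[OF assms(2) openin_Euclidean_space_0]
      smooth_family_const[OF assms(3) openin_Euclidean_space_0]
      smooth_family_const[OF assms(4) openin_Euclidean_space_0]] by simp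

text \<open>With one slot held fixed, first derivatives can be differentiated again, as the exterior
  derivative of \<open>d_one_form\<close> requires.\<close>

lemma smooth_form_dir_deriv:
  assumes "smooth_form F" "k \<in> C_inf"
  shows "smooth_form (\<lambda>c h. dir_deriv h (\<lambda>c. F c k) c)" "smooth_form (\<lambda>c h. dir_deriv k (\<lambda>c. F c h) c)"
  unfolding smooth_form_def
  using smooth_dir_deriv[OF assms(1)] smooth_family_const[OF assms(2) smooth_family_open]
  by blast+

section \<open>Two-parameter variations\<close>

definition pt2 :: "real \<Rightarrow> real \<Rightarrow> nat \<Rightarrow> real"
  where "pt2 s t = (\<lambda>_. 0)(0 := s, 1 := t)"

lemma pt2_simps [simp]:
  "pt2 s t 0 = s" "pt2 s t (Suc 0) = t" "(pt2 s t)(0 := u) = pt2 u t" "(pt2 s t)(Suc 0 := u) = pt2 s u"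
  by (auto simp: pt2_def fun_eq_iff)

lemma pt2_mem: "pt2 s t \<in> topspace (Euclidean_space 2)"
  by (simp add: pt2_def mem_Euclidean_space)

lemma continuous_on_pt2:
  assumes "continuous_on S f" "continuous_on S g"
  shows "continuous_on S (\<lambda>x. pt2 (f x) (g x))"
  unfolding pt2_def by (intro continuous_on_fun_upd continuous_on_const assms)

lemma open_pt2:
  assumes "openin (Euclidean_space 2) V"
  shows "open {z. pt2 (fst z) (snd z) \<in> V}"
proof -
  have "continuous_on UNIV (\<lambda>z. pt2 (fst z) (snd z))"
    by (intro continuous_on_pt2 continuous_on_fst continuous_on_snd continuous_on_id)
  from open_Euclidean_preimage[OF assms this open_UNIV pt2_mem] show ?thesis by simp
qed

lemma pt2_partials:
  assumes "smooth_on_Rn 2 V A"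
  obtains A0 A1 where "smooth_on_Rn 2 V A0" "smooth_on_Rn 2 V A1"
    "\<And>s t. pt2 s t \<in> V \<Longrightarrow> ((\<lambda>s. A (pt2 s t)) has_vector_derivative A0 (pt2 s t)) (at s)"
    "\<And>s t. pt2 s t \<in> V \<Longrightarrow> ((\<lambda>t. A (pt2 s t)) has_vector_derivative A1 (pt2 s t)) (at t)"
proof -
  obtain A0 where A0: "smooth_on_Rn 2 V A0"
    "\<And>x. x \<in> V \<Longrightarrow> ((\<lambda>t. A (x(0 := t))) has_vector_derivative A0 x) (at (x 0))"
    using smooth_on_Rn_partial[OF assms, of 0] by auto
  obtain A1 where A1: "smooth_on_Rn 2 V A1"
    "\<And>x. x \<in> V \<Longrightarrow> ((\<lambda>t. A (x(1 := t))) has_vector_derivative A1 x) (at (x 1))"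
    using smooth_on_Rn_partial[OF assms, of 1] by auto
  from that[OF A0(1) A1(1)] A0(2)[of "pt2 _ _"] A1(2)[of "pt2 _ _"] show thesis by simp
qed

text \<open>Chain rule along (t, t): smoothness of \<open>A\<close> identifies the two axis
  derivatives with partial derivatives, and these add up. It splits a curve whose time enters in two
  places.\<close>

lemma diagonal_derivative:
  fixes A :: "(nat \<Rightarrow> real) \<Rightarrow> real"
  assumes A: "smooth_on_Rn 2 V A" and V: "pt2 0 0 \<in> V"
    and a: "((\<lambda>s. A (pt2 s 0)) has_real_derivative a) (at 0)"
    and b: "((\<lambda>t. A (pt2 0 t)) has_real_derivative b) (at 0)"
  shows "((\<lambda>t. A (pt2 t t)) has_real_derivative a + b) (at 0)"
proof -
  obtain A0 A1 where A01: "smooth_on_Rn 2 V A0" "smooth_on_Rn 2 V A1"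
    "\<And>s t. pt2 s t \<in> V \<Longrightarrow> ((\<lambda>s. A (pt2 s t)) has_vector_derivative A0 (pt2 s t)) (at s)"
    "\<And>s t. pt2 s t \<in> V \<Longrightarrow> ((\<lambda>t. A (pt2 s t)) has_vector_derivative A1 (pt2 s t)) (at t)"
    using pt2_partials[OF A] by blast
  have ab: "A0 (pt2 0 0) = a" "A1 (pt2 0 0) = b"
    using A01(3,4)[OF V] a b
    by (auto simp: has_real_derivative_iff_has_vector_derivative intro: vector_derivative_unique_at)
  define f' where "f' = (\<lambda>j::nat. if j = 0 then A0 else A1)"
  have Vo: "openin (Euclidean_space 2) V" by (rule smooth_on_Rn_open[OF A])
  have "continuous_on UNIV (\<lambda>t. pt2 t t)" by (intro continuous_on_pt2 continuous_on_id)
  from open_Euclidean_preimage[OF Vo this open_UNIV pt2_mem]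
  have T: "open {t. pt2 t t \<in> V}" by simp
  have two: "{..<2::nat} = {0, Suc 0}" by auto
  have V_eq: "x = pt2 (x 0) (x 1)" if "x \<in> V" for x
    using openin_Euclidean_topspace[OF Vo that]
    by (auto simp: pt2_def mem_Euclidean_space fun_eq_iff)
  have "((\<lambda>t. A (pt2 t t)) has_vector_derivative (\<Sum>j<2. (1::real) *\<^sub>R f' j (pt2 0 0))) (at 0)"
  proof (rule chain_rule_curve[OF Vo T])
    fix j :: nat assume "j < 2"
    hence j: "j = 0 \<or> j = Suc 0" by auto
    show "continuous_on {t. pt2 t t \<in> V} (\<lambda>t. pt2 t t j)"
      using j by auto
    show "((\<lambda>t. pt2 t t j) has_vector_derivative 1) (at 0)" using j by auto
    show "continuous_on V (f' j)" using A01(1,2) by (simp add: f'_def smooth_on_Rn_continuous)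
    fix x assume x: "x \<in> V"
    define u v where "u = x 0" and "v = x 1"
    have xe: "x = pt2 u v" using V_eq[OF x] by (simp add: u_def v_def)
    show "((\<lambda>t. A (x(j := t))) has_vector_derivative f' j x) (at (x j))"
      using j A01(3,4)[of u v] x unfolding xe by (auto simp: f'_def)
  qed (use V in auto)
  thus ?thesis by (simp add: two f'_def ab has_real_derivative_iff_has_vector_derivative)
qed

text \<open>The affine surface behind additivity of \<open>dir_deriv\<close> in the direction,
  behind openness of \<open>Imm\<close> along lines, and behind commuting derivatives.\<close>

lemma two_parameter_family:
  assumes "c \<in> Imm" "h \<in> C_inf" "k \<in> C_inf"
  defines "C \<equiv> (\<lambda>x \<theta>. c \<theta> + x 0 *\<^sub>R h \<theta> + x (1::nat) *\<^sub>R k \<theta>)"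
  defines "V \<equiv> {x \<in> topspace (Euclidean_space 2). C x \<in> Imm}"
  shows "Imm_family 2 V C" "pt2 0 0 \<in> V"
proof -
  let ?T = "topspace (Euclidean_space 2)"
  have co: "smooth_on_Rn 2 ?T (\<lambda>x. x j)" for j by (rule smooth_on_Rn_coord[OF openin_topspace])
  have C: "smooth_family 2 ?T C" unfolding C_def
    by (intro smooth_family_add smooth_family_scaleR co smooth_family_const openin_topspace
        Imm_C_inf assms(1-3))
  thus "Imm_family 2 V C" unfolding V_def by (rule smooth_family_Imm_restrict)
  show "pt2 0 0 \<in> V" using assms(1) pt2_mem by (simp add: V_def C_def)
qed

text \<open>Derivatives along single lines need not add up; joint smoothness in (s, t) of the form
  at c + s h + t k does it, on the diagonal.\<close>

lemma dir_deriv_add: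
  assumes F: "smooth_form F" and c: "c \<in> Imm" and hk: "h \<in> C_inf" "k \<in> C_inf" and l: "l \<in> C_inf"
  shows "dir_deriv (\<lambda>\<theta>. h \<theta> + k \<theta>) (\<lambda>c. F c l) c = dir_deriv h (\<lambda>c. F c l) c + dir_deriv k (\<lambda>c. F c l) c"
proof (rule dir_deriv_eqI)
  note fam = two_parameter_family[OF c hk]
  have "smooth_on_Rn 2 {x \<in> topspace (Euclidean_space 2). (\<lambda>\<theta>. c \<theta> + x 0 *\<^sub>R h \<theta> + x 1 *\<^sub>R k \<theta>) \<in> Imm}
      (\<lambda>x. F (\<lambda>\<theta>. c \<theta> + x 0 *\<^sub>R h \<theta> + x 1 *\<^sub>R k \<theta>) l)"
    by (rule smooth_formD[OF F fam(1) smooth_family_const[OF l]])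
      (use fam(1) smooth_family_open in \<open>auto simp: Imm_family_def\<close>)
  from diagonal_derivative[OF this fam(2)] dir_deriv_works[OF F c hk(1) l] dir_deriv_works[OF F c hk(2) l]
  show "((\<lambda>t. F (\<lambda>\<theta>. c \<theta> + t *\<^sub>R (h \<theta> + k \<theta>)) l) has_real_derivative
      dir_deriv h (\<lambda>c. F c l) c + dir_deriv k (\<lambda>c. F c l) c) (at 0)"
    by (simp add: scaleR_add_right add.assoc)
qed

lemma dir_deriv_scaleR:
  assumes F: "smooth_form F" and c: "c \<in> Imm" and h: "h \<in> C_inf" and l: "l \<in> C_inf"
  shows "dir_deriv (\<lambda>\<theta>. r *\<^sub>R h \<theta>) (\<lambda>c. F c l) c = r * dir_deriv h (\<lambda>c. F c l) c"
proof (rule dir_deriv_eqI)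
  have "((\<lambda>t. t * r) has_real_derivative r) (at 0)" by (auto intro!: derivative_eq_intros)
  moreover have "((\<lambda>t. F (\<lambda>\<theta>. c \<theta> + t *\<^sub>R h \<theta>) l) has_real_derivative dir_deriv h (\<lambda>c. F c l) c) (at (0 * r))"
    using dir_deriv_works[OF F c h l] by simp
  ultimately show "((\<lambda>t. F (\<lambda>\<theta>. c \<theta> + t *\<^sub>R r *\<^sub>R h \<theta>) l) has_real_derivative r * dir_deriv h (\<lambda>c. F c l) c) (at 0)"
    using DERIV_chain2[of "\<lambda>t. F (\<lambda>\<theta>. c \<theta> + t *\<^sub>R h \<theta>) l" _ "\<lambda>t. t * r" 0 r UNIV]
    by (simp add: mult.commute[of r "dir_deriv _ _ _"])
qed

lemma eventually_Imm:
  assumes "c \<in> Imm" "h \<in> C_inf"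
  shows "\<forall>\<^sub>F t in nhds 0. (\<lambda>\<theta>. c \<theta> + t *\<^sub>R h \<theta>) \<in> Imm"
proof -
  \<comment> \<open>The second direction is taken to be the zero curve, so only the first axis
    matters.\<close>
  note fam = two_parameter_family[OF assms C_inf_const]
  let ?V = "{x \<in> topspace (Euclidean_space 2). (\<lambda>\<theta>. c \<theta> + x 0 *\<^sub>R h \<theta> + x 1 *\<^sub>R 0) \<in> Imm}"
  have V: "openin (Euclidean_space 2) ?V"
    using fam(1) smooth_family_open unfolding Imm_family_def by blast
  have "continuous_on UNIV (\<lambda>t. pt2 t 0)" by (intro continuous_on_pt2 continuous_on_id continuous_on_const)
  from open_Euclidean_preimage[OF V this open_UNIV pt2_mem]
  have "open {t. (\<lambda>\<theta>. c \<theta> + t *\<^sub>R h \<theta>) \<in> Imm}" by (simp add: pt2_mem)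
  from eventually_nhds_in_open[OF this, of 0] show ?thesis using assms(1) by simp
qed

text \<open>Agreement on \<open>Imm\<close> is enough because a line starting at an immersion
  consists of immersions for small times.\<close>

lemma dir_deriv_cong:
  assumes "c \<in> Imm" "h \<in> C_inf" "\<And>c. c \<in> Imm \<Longrightarrow> F c = G c"
  shows "dir_deriv h F c = dir_deriv h G c"
  unfolding dir_deriv_def
  by (rule deriv_cong_ev[OF eventually_mono[OF eventually_Imm[OF assms(1,2)]] refl]) (rule assms(3))

text \<open>The outer derivative sees the inner one at neighbouring points of the surface
  \<open>C\<close>, where it is the partial derivative \<open>A0\<close> or \<open>A1\<close>;
  symmetry of the mixed partial derivatives at the origin then gives the claim.\<close>

lemma dir_deriv_commute:
  assumes F: "smooth_form F" and c: "c \<in> Imm" and h: "h \<in> C_inf" and k: "k \<in> C_inf" and l: "l \<in> C_inf"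
  shows "dir_deriv h (\<lambda>c. dir_deriv k (\<lambda>c. F c l) c) c = dir_deriv k (\<lambda>c. dir_deriv h (\<lambda>c. F c l) c) c"
proof -
  define C where "C = (\<lambda>x \<theta>. c \<theta> + x 0 *\<^sub>R h \<theta> + x (1::nat) *\<^sub>R k \<theta>)"
  define V where "V = {x \<in> topspace (Euclidean_space 2). C x \<in> Imm}"
  have fam: "Imm_family 2 V C" and V0: "pt2 0 0 \<in> V"
    using two_parameter_family[OF c h k] unfolding V_def C_def .
  have Vo: "openin (Euclidean_space 2) V"
    using fam smooth_family_open unfolding Imm_family_def by blast
  have A: "smooth_on_Rn 2 V (\<lambda>x. F (C x) l)"
    by (rule smooth_formD[OF F fam smooth_family_const[OF l Vo]])
  obtain A0 A1 where A01: "smooth_on_Rn 2 V A0" "smooth_on_Rn 2 V A1"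
    "\<And>s t. pt2 s t \<in> V \<Longrightarrow> ((\<lambda>s. F (C (pt2 s t)) l) has_vector_derivative A0 (pt2 s t)) (at s)"
    "\<And>s t. pt2 s t \<in> V \<Longrightarrow> ((\<lambda>t. F (C (pt2 s t)) l) has_vector_derivative A1 (pt2 s t)) (at t)"
    using pt2_partials[OF A] by blast
  obtain A00 A01' where A01': "smooth_on_Rn 2 V A00" "smooth_on_Rn 2 V A01'"
    "\<And>s t. pt2 s t \<in> V \<Longrightarrow> ((\<lambda>s. A0 (pt2 s t)) has_vector_derivative A00 (pt2 s t)) (at s)"
    "\<And>s t. pt2 s t \<in> V \<Longrightarrow> ((\<lambda>t. A0 (pt2 s t)) has_vector_derivative A01' (pt2 s t)) (at t)"
    using pt2_partials[OF A01(1)] by blast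
  obtain A10' A11 where A10': "smooth_on_Rn 2 V A10'" "smooth_on_Rn 2 V A11"
    "\<And>s t. pt2 s t \<in> V \<Longrightarrow> ((\<lambda>s. A1 (pt2 s t)) has_vector_derivative A10' (pt2 s t)) (at s)"
    "\<And>s t. pt2 s t \<in> V \<Longrightarrow> ((\<lambda>t. A1 (pt2 s t)) has_vector_derivative A11 (pt2 s t)) (at t)"
    using pt2_partials[OF A01(2)] by blast
  \<comment> \<open>\<open>dir_deriv\<close> restarts its clock at 0 at each point of the surface,
    whereas the partial derivative is taken at the running parameter value.\<close>
  have shift: "((\<lambda>u. f (a + u)) has_real_derivative d) (at 0)"
    if "(f has_vector_derivative d) (at a)" for f :: "real \<Rightarrow> real" and a d
    using that DERIV_shift[of f d 0 a] by (simp add: has_real_derivative_iff_has_vector_derivative add.commute)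
  have d0: "dir_deriv h (\<lambda>c. F c l) (C (pt2 s t)) = A0 (pt2 s t)" if "pt2 s t \<in> V" for s t
    by (rule dir_deriv_eqI) (use shift[OF A01(3)[OF that]] in \<open>simp add: C_def algebra_simps\<close>)
  have d1: "dir_deriv k (\<lambda>c. F c l) (C (pt2 s t)) = A1 (pt2 s t)" if "pt2 s t \<in> V" for s t
    by (rule dir_deriv_eqI) (use shift[OF A01(4)[OF that]] in \<open>simp add: C_def algebra_simps\<close>)
  define S where "S = {z. pt2 (fst z) (snd z) \<in> V}"
  have S: "open S" unfolding S_def by (rule open_pt2[OF Vo])
  have ev: "\<forall>\<^sub>F t in nhds 0. pt2 t 0 \<in> V" "\<forall>\<^sub>F t in nhds 0. pt2 0 t \<in> V"
    using eventually_Imm[OF c h] eventually_Imm[OF c k]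
    by (auto simp: V_def C_def pt2_mem elim!: eventually_mono)
  have cS: "continuous_on S (\<lambda>(s, t). f (pt2 s t))" if "smooth_on_Rn 2 V f" for f :: "(nat \<Rightarrow> real) \<Rightarrow> real"
    unfolding split_beta
    by (rule continuous_on_compose2[OF smooth_on_Rn_continuous[OF that]
          continuous_on_pt2[OF continuous_on_fst[OF continuous_on_id] continuous_on_snd[OF continuous_on_id]]])
      (auto simp: S_def)
  have "dir_deriv k (\<lambda>c. dir_deriv h (\<lambda>c. F c l) c) c = A01' (pt2 0 0)"
  proof -
    have "((\<lambda>t. dir_deriv h (\<lambda>c. F c l) (C (pt2 0 t))) has_real_derivative A01' (pt2 0 0)) (at 0)"
    proof (subst DERIV_cong_ev[OF refl eventually_mono[OF ev(2) d0] refl])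
      show "((\<lambda>t. A0 (pt2 0 t)) has_real_derivative A01' (pt2 0 0)) (at 0)"
        using A01'(4)[OF V0] by (simp add: has_real_derivative_iff_has_vector_derivative)
    qed
    thus ?thesis by (intro dir_deriv_eqI) (simp add: C_def)
  qed
  moreover have "dir_deriv h (\<lambda>c. dir_deriv k (\<lambda>c. F c l) c) c = A10' (pt2 0 0)"
  proof -
    have "((\<lambda>t. dir_deriv k (\<lambda>c. F c l) (C (pt2 t 0))) has_real_derivative A10' (pt2 0 0)) (at 0)"
    proof (subst DERIV_cong_ev[OF refl eventually_mono[OF ev(1) d1] refl])
      show "((\<lambda>t. A1 (pt2 t 0)) has_real_derivative A10' (pt2 0 0)) (at 0)"
        using A10'(3)[OF V0] by (simp add: has_real_derivative_iff_has_vector_derivative)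
    qed
    thus ?thesis by (intro dir_deriv_eqI) (simp add: C_def)
  qed
  moreover have "A01' (pt2 0 0) = A10' (pt2 0 0)"
  proof (rule mixed_partials_commute[OF S, where G = "\<lambda>s t. F (C (pt2 s t)) l" and Gs = "\<lambda>s t. A0 (pt2 s t)"
        and Gt = "\<lambda>s t. A1 (pt2 s t)" and Gst = "\<lambda>s t. A01' (pt2 s t)" and Gts = "\<lambda>s t. A10' (pt2 s t)"])
    show "(0, 0) \<in> S" using V0 by (simp add: S_def)
  qed (use A01(3,4) A01'(4) A10'(3) cS[OF A01'(2)] cS[OF A10'(1)] in
      \<open>simp_all add: S_def has_real_derivative_iff_has_vector_derivative\<close>)
  ultimately show ?thesis by simp
qed

section \<open>Invariant one-forms that vanish on vertical vectors\<close>

definition linear_form :: "(curve \<Rightarrow> curve \<Rightarrow> real) \<Rightarrow> bool"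
  where "linear_form F \<longleftrightarrow> (\<forall>c\<in>Imm. linear_on_C_inf (F c))"

lemma linear_form_add:
  "linear_form F \<Longrightarrow> c \<in> Imm \<Longrightarrow> h \<in> C_inf \<Longrightarrow> k \<in> C_inf \<Longrightarrow> F c (\<lambda>\<theta>. h \<theta> + k \<theta>) = F c h + F c k"
  and linear_form_scaleR:
  "linear_form F \<Longrightarrow> c \<in> Imm \<Longrightarrow> h \<in> C_inf \<Longrightarrow> F c (\<lambda>\<theta>. r *\<^sub>R h \<theta>) = r * F c h"
  unfolding linear_form_def linear_on_C_inf_def by blast+

lemma dir_deriv_diff:
  assumes F: "smooth_form F" "k \<in> C_inf" and G: "smooth_form G" "l \<in> C_inf"
    and c: "c \<in> Imm" and h: "h \<in> C_inf"
  shows "dir_deriv h (\<lambda>c. F c k - G c l) c = dir_deriv h (\<lambda>c. F c k) c - dir_deriv h (\<lambda>c. G c l) c"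
  by (rule dir_deriv_eqI[OF DERIV_diff[OF dir_deriv_works[OF F(1) c h F(2)] dir_deriv_works[OF G(1) c h G(2)]]])

lemma linear_dir_deriv_direction:
  assumes "smooth_form F" "c \<in> Imm" "k \<in> C_inf"
  shows "linear_on_C_inf (\<lambda>h. dir_deriv h (\<lambda>c. F c k) c)"
  unfolding linear_on_C_inf_def
  using dir_deriv_add[OF assms(1,2) _ _ assms(3)] dir_deriv_scaleR[OF assms(1,2) _ assms(3)] by blast

lemma linear_dir_deriv_argument:
  assumes F: "smooth_form F" "linear_form F" and c: "c \<in> Imm" and h: "h \<in> C_inf"
  shows "linear_on_C_inf (\<lambda>k. dir_deriv h (\<lambda>c. F c k) c)"
  unfolding linear_on_C_inf_def
proof (intro conjI ballI allI)
  fix k l :: curve assume k: "k \<in> C_inf" and l: "l \<in> C_inf"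
  have "dir_deriv h (\<lambda>c. F c (\<lambda>\<theta>. k \<theta> + l \<theta>)) c = dir_deriv h (\<lambda>c. F c k + F c l) c"
    by (rule dir_deriv_cong[OF c h]) (rule linear_form_add[OF F(2) _ k l])
  also have "\<dots> = dir_deriv h (\<lambda>c. F c k) c + dir_deriv h (\<lambda>c. F c l) c"
    by (rule dir_deriv_eqI[OF DERIV_add[OF dir_deriv_works[OF F(1) c h k] dir_deriv_works[OF F(1) c h l]]])
  finally show "dir_deriv h (\<lambda>c. F c (\<lambda>\<theta>. k \<theta> + l \<theta>)) c = dir_deriv h (\<lambda>c. F c k) c + dir_deriv h (\<lambda>c. F c l) c" .
next
  fix k :: curve and r assume k: "k \<in> C_inf"
  have "dir_deriv h (\<lambda>c. F c (\<lambda>\<theta>. r *\<^sub>R k \<theta>)) c = dir_deriv h (\<lambda>c. r * F c k) c"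
    by (rule dir_deriv_cong[OF c h]) (rule linear_form_scaleR[OF F(2) _ k])
  also have "\<dots> = r * dir_deriv h (\<lambda>c. F c k) c"
    by (rule dir_deriv_eqI[OF DERIV_cmult[OF dir_deriv_works[OF F(1) c h k]]])
  finally show "dir_deriv h (\<lambda>c. F c (\<lambda>\<theta>. r *\<^sub>R k \<theta>)) c = r * dir_deriv h (\<lambda>c. F c k) c" .
qed

lemma two_form_d_one_form:
  assumes F: "smooth_form F" "linear_form F"
  shows "two_form (\<lambda>c h k. - d_one_form F c h k)"
  unfolding two_form_def bilinear_field_def
proof (intro conjI ballI allI impI)
  fix c h :: curve assume c: "c \<in> Imm" and h: "h \<in> C_inf"
  note lin = linear_dir_deriv_direction[OF F(1) c h] linear_dir_deriv_argument[OF F c h]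
  show "linear_on_C_inf (\<lambda>k. - d_one_form F c h k)" "linear_on_C_inf (\<lambda>k. - d_one_form F c k h)"
    using lin unfolding linear_on_C_inf_def d_one_form_def by (simp_all add: algebra_simps)
  show "- d_one_form F c h h = 0" by (simp add: d_one_form_def)
next
  fix n U c and h k :: "(nat \<Rightarrow> real) \<Rightarrow> curve"
  assume fam: "Imm_family n U c" "smooth_family n U h" "smooth_family n U k"
  show "smooth_on_Rn n U (\<lambda>x. - d_one_form F (c x) (h x) (k x))"
    by (rule smooth_on_Rn_cong[OF smooth_on_Rn_diff[OF smooth_dir_deriv[OF F(1) fam(1,3,2)]
            smooth_dir_deriv[OF F(1) fam(1,2,3)]]]) (simp add: d_one_form_def)
qed

text \<open>Six second directional derivatives occur; they cancel in pairs as soon as the two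
  directions may be exchanged.\<close>

lemma closed_d_one_form:
  assumes F: "smooth_form F"
  shows "closed_two_form (\<lambda>c h k. - d_one_form F c h k)"
  unfolding closed_two_form_def
proof (intro ballI)
  fix c h k l :: curve assume c: "c \<in> Imm" and hkl: "h \<in> C_inf" "k \<in> C_inf" "l \<in> C_inf"
  have *: "dir_deriv h (\<lambda>c. - d_one_form F c k l) c =
      dir_deriv h (\<lambda>c. dir_deriv l (\<lambda>c. F c k) c) c - dir_deriv h (\<lambda>c. dir_deriv k (\<lambda>c. F c l) c) c"
    if "h \<in> C_inf" "k \<in> C_inf" "l \<in> C_inf" for h k l
    using dir_deriv_diff[OF smooth_form_dir_deriv(1)[OF F that(2)] that(3)
        smooth_form_dir_deriv(1)[OF F that(3)] that(2) c that(1)]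
    by (simp add: d_one_form_def)
  show "d_two_form (\<lambda>c h k. - d_one_form F c h k) c h k l = 0"
    unfolding d_two_form_def using hkl
    by (simp add: * dir_deriv_commute[OF F c, of h l] dir_deriv_commute[OF F c, of k l]
        dir_deriv_commute[OF F c, of h k])
qed

text \<open>Composition with \<phi> is linear in the curve, so it maps the line through
  \<open>c\<close> in direction \<open>h\<close> to the line through c o \<phi> in direction h o
  \<phi>. The two functions of \<open>t\<close> agree near 0.\<close>

lemma dir_deriv_invariant:
  assumes inv: "\<And>\<phi> c h. \<phi> \<in> Diff_plus \<Longrightarrow> c \<in> Imm \<Longrightarrow> h \<in> C_inf \<Longrightarrow> F (c \<circ> \<phi>) (h \<circ> \<phi>) = F c h"
    and \<phi>: "\<phi> \<in> Diff_plus" and c: "c \<in> Imm" and hk: "h \<in> C_inf" "k \<in> C_inf"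
  shows "dir_deriv (h \<circ> \<phi>) (\<lambda>c. F c (k \<circ> \<phi>)) (c \<circ> \<phi>) = dir_deriv h (\<lambda>c. F c k) c"
  unfolding dir_deriv_def
proof (rule deriv_cong_ev[OF eventually_mono[OF eventually_Imm[OF c hk(1)]] refl])
  fix t assume "(\<lambda>\<theta>. c \<theta> + t *\<^sub>R h \<theta>) \<in> Imm"
  from inv[OF \<phi> this hk(2)]
  show "F (\<lambda>\<theta>. (c \<circ> \<phi>) \<theta> + t *\<^sub>R (h \<circ> \<phi>) \<theta>) (k \<circ> \<phi>) = F (\<lambda>\<theta>. c \<theta> + t *\<^sub>R h \<theta>) k"
    by (simp add: o_def)
qed

lemma C_inf_bounded:
  fixes f :: "real \<Rightarrow> 'b::real_normed_vector"
  assumes "f \<in> C_inf"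
  obtains M where "M > 0" "\<And>\<theta>. norm (f \<theta>) \<le> M"
proof -
  have "bounded (f ` {0..2*pi})"
    by (intro compact_imp_bounded compact_continuous_image C_inf_continuous[OF assms] compact_Icc)
  then obtain M where M: "M > 0" "\<forall>z\<in>f ` {0..2*pi}. norm z \<le> M"
    unfolding bounded_pos by blast
  have "norm (f \<theta>) \<le> M" for \<theta>
  proof -
    obtain \<theta>' where "\<theta>' \<in> {0..2*pi}" "f \<theta>' = f \<theta>"
      using periodic_representative[of f \<theta>] assms by (auto simp: C_inf_def)
    thus ?thesis using M(2) by (metis imageI)
  qed
  thus thesis using that M(1) by blast
qed

lemma eventually_Diff_plus:
  assumes a: "a \<in> C_inf"
  shows "\<forall>\<^sub>F t in nhds 0. (\<lambda>\<theta>. \<theta> + t * a \<theta>) \<in> Diff_plus"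
proof -
  obtain M where M: "M > 0" "\<And>\<theta>. norm (D\<theta> a \<theta>) \<le> M" using C_inf_bounded[OF C_inf_D\<theta>[OF a]] by blast
  \<comment> \<open>With the derivative of \<open>a\<close> bounded by \<open>M\<close>, the bound 1
    / M on the time keeps 1 + t a' positive.\<close>
  have "(\<lambda>\<theta>. \<theta> + t * a \<theta>) \<in> Diff_plus" if t: "\<bar>t\<bar> < 1 / M" for t
  proof -
    let ?\<phi> = "\<lambda>\<theta>. \<theta> + t * a \<theta>"
    have d: "D\<theta> ?\<phi> \<theta> = 1 + t * D\<theta> a \<theta>" for \<theta>
      by (rule D\<theta>_eqI) (use C_inf_has_derivative[OF a] in \<open>auto intro!: derivative_eq_intros\<close>)
    have "D\<theta> ?\<phi> \<theta> > 0" for \<theta>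
    proof -
      have "\<bar>t * D\<theta> a \<theta>\<bar> \<le> \<bar>t\<bar> * M" using M(2)[of \<theta>] by (simp add: abs_mult mult_left_mono)
      also have "\<dots> < 1" using t M(1) by (simp add: pos_less_divide_eq)
      finally show ?thesis unfolding d by linarith
    qed
    moreover have "smooth_real ?\<phi>"
    proof -
      have co: "smooth_on_Rn 1 (topspace (Euclidean_space 1)) (\<lambda>x. x 0)"
        by (rule smooth_on_Rn_coord[OF openin_topspace])
      have "smooth_on_Rn 1 (topspace (Euclidean_space 1)) (\<lambda>x. x 0 + t * a (x 0))"
        by (rule smooth_on_Rn_add[OF co smooth_on_Rn_mult[OF smooth_on_Rn_const[OF openin_topspace]
                smooth_on_Rn_smooth_real[OF _ co]]]) (use a in \<open>simp add: C_inf_def\<close>)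
      from smooth_real_line[OF this, of 0 "\<lambda>_. 0"] show ?thesis by (simp add: mem_Euclidean_space)
    qed
    ultimately show ?thesis using C_inf_periodic[OF a] by (simp add: Diff_plus_def)
  qed
  moreover have "\<forall>\<^sub>F t in nhds 0. \<bar>t\<bar> < 1 / M"
    using M(1) by (intro order_tendstoD(2)[where y = "0::real"] tendsto_eq_intros) (auto simp: filterlim_ident)
  ultimately show ?thesis by (rule eventually_mono[rotated])
qed

text \<open>Hadamard's lemma for \<open>f (\<theta> + t a(\<theta>))\<close>: the difference quotient in \<open>t\<close> extends smoothly to
  \<open>t = 0\<close>. It turns the curve of reparametrised immersions into an affine variation with a smoothly
  varying direction, for which only directional derivatives are needed.\<close>

definition displacement :: "(real \<Rightarrow> real) \<Rightarrow> curve \<Rightarrow> real \<Rightarrow> curve"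
  where "displacement a f t = (\<lambda>\<theta>. integral {0..1} (\<lambda>u. a \<theta> *\<^sub>R D\<theta> f (\<theta> + u * t * a \<theta>)))"

lemma displacement_0: "displacement a f 0 = vertical f a"
  by (simp add: displacement_def vertical_def)

text \<open>Fundamental theorem in \<open>u\<close> between 0 and 1 for f(\<theta> + u t
  a(\<theta>)). The factor \<open>t\<close> is pulled out of the integrand rather than divided away,
  so t = 0 is included.\<close>

lemma displacement_eq:
  assumes "f \<in> C_inf"
  shows "f \<theta> + t *\<^sub>R displacement a f t \<theta> = f (\<theta> + t * a \<theta>)"
proof -
  have "((\<lambda>u. t *\<^sub>R (a \<theta> *\<^sub>R D\<theta> f (\<theta> + u * t * a \<theta>))) has_integral
      f (\<theta> + 1 * t * a \<theta>) - f (\<theta> + 0 * t * a \<theta>)) {0..1}"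
  proof (rule fundamental_theorem_of_calculus)
    fix u
    have "((\<lambda>u. \<theta> + u * t * a \<theta>) has_vector_derivative t * a \<theta>) (at u)"
      by (auto intro!: derivative_eq_intros)
    from vector_diff_chain_at[OF this C_inf_has_derivative[OF assms]]
    have "((\<lambda>u. f (\<theta> + u * t * a \<theta>)) has_vector_derivative t *\<^sub>R (a \<theta> *\<^sub>R D\<theta> f (\<theta> + u * t * a \<theta>))) (at u)"
      by (simp add: o_def)
    thus "((\<lambda>u. f (\<theta> + u * t * a \<theta>)) has_vector_derivative t *\<^sub>R (a \<theta> *\<^sub>R D\<theta> f (\<theta> + u * t * a \<theta>))) (at u within {0..1})"
      by (rule has_vector_derivative_at_within)
  qed simp
  from integral_unique[OF this] show ?thesis by (simp add: displacement_def)
qed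

lemma smooth_family_displacement:
  assumes f: "f \<in> C_inf" and a: "a \<in> C_inf"
  shows "smooth_family 2 (topspace (Euclidean_space 2)) (\<lambda>x. displacement a f (x 1))"
proof (rule smooth_familyI[OF openin_topspace])
  have sa: "smooth_real a" and sf: "smooth_real (D\<theta> f)"
    using a C_inf_D\<theta>[OF f] by (simp_all add: C_inf_def)
  show "periodic (displacement a f (x 1))" for x :: "nat \<Rightarrow> real"
    unfolding periodic_def
  proof
    fix \<theta>
    have "D\<theta> f (\<theta> + 2 * pi + u * x 1 * a \<theta>) = D\<theta> f (\<theta> + u * x 1 * a \<theta>)" for u
      using C_inf_periodic[OF C_inf_D\<theta>[OF f], of "\<theta> + u * x 1 * a \<theta>"] by (simp add: algebra_simps)
    thus "displacement a f (x 1) (\<theta> + 2 * pi) = displacement a f (x 1) \<theta>"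
      unfolding displacement_def C_inf_periodic[OF a] by simp
  qed
  let ?C = "{y \<in> topspace (Euclidean_space (Suc 2)). y(2 := 0) \<in> topspace (Euclidean_space 2)}"
  have C: "openin (Euclidean_space (Suc 2)) ?C" by (rule openin_cylinder[OF openin_topspace])
  \<comment> \<open>Coordinate 1 is the time \<open>t\<close>, coordinate 2 the angle, coordinate 3
    the integration variable \<open>u\<close>. Coordinate 0 is reserved for the scaling of the
    displacement in the surface built later.\<close>
  let ?D = "{z \<in> topspace (Euclidean_space (Suc (Suc 2))). z(Suc 2 := 0) \<in> ?C}"
  have co: "smooth_on_Rn (Suc (Suc 2)) ?D (\<lambda>z. z j)" for j
    by (rule smooth_on_Rn_coord[OF openin_cylinder[OF C]])
  have az: "smooth_on_Rn (Suc (Suc 2)) ?D (\<lambda>z. a (z 2))"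
    by (rule smooth_on_Rn_smooth_real[OF sa co])
  have "smooth_on_Rn (Suc (Suc 2)) ?D (\<lambda>z. a (z 2) *\<^sub>R D\<theta> f (z 2 + z 3 * z 1 * a (z 2)))"
    by (rule smooth_on_Rn_scaleR[OF az smooth_on_Rn_smooth_real[OF sf
          smooth_on_Rn_add[OF co smooth_on_Rn_mult[OF smooth_on_Rn_mult[OF co co] az]]]])
  from smooth_on_Rn_integral[OF C this, of 0 1]
  show "smooth_on_Rn (Suc 2) ?C (\<lambda>y. displacement a f ((y(2 := 0)) 1) (y 2))"
    by (simp add: displacement_def)
qed

section \<open>Contraction of the exterior derivative with a vertical field\<close>

context
  fixes F :: "curve \<Rightarrow> curve \<Rightarrow> real"
  assumes F: "smooth_form F" "linear_form F"
    and invariant: "\<And>\<phi> c h. \<phi> \<in> Diff_plus \<Longrightarrow> c \<in> Imm \<Longrightarrow> h \<in> C_inf \<Longrightarrow> F (c \<circ> \<phi>) (h \<circ> \<phi>) = F c h"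
    and horizontal: "\<And>c a. c \<in> Imm \<Longrightarrow> a \<in> C_inf \<Longrightarrow> F c (vertical c a) = 0"
begin

lemma dir_deriv_on_vertical:
  assumes c: "c \<in> Imm" and a: "a \<in> C_inf" and k: "k \<in> C_inf"
  shows "dir_deriv k (\<lambda>c'. F c' (vertical c a)) c = - F c (vertical k a)"
proof (rule dir_deriv_eqI)
  let ?c = "\<lambda>t \<theta>. c \<theta> + t *\<^sub>R k \<theta>" and ?w = "vertical k a"
  note cC = Imm_C_inf[OF c]
  have w: "?w \<in> C_inf" and v: "vertical c a \<in> C_inf" using vertical_C_inf a k cC by blast+
  have "F (?c t) (vertical c a) = - (t * F (?c t) ?w)" if "?c t \<in> Imm" for t
  proof -
    have "D\<theta> (?c t) \<theta> = D\<theta> c \<theta> + t *\<^sub>R D\<theta> k \<theta>" for \<theta>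
      by (rule D\<theta>_eqI) (use C_inf_has_derivative[OF cC] C_inf_has_derivative[OF k] in
          \<open>auto intro!: derivative_eq_intros\<close>)
    hence "vertical (?c t) a = (\<lambda>\<theta>. vertical c a \<theta> + t *\<^sub>R ?w \<theta>)"
      by (simp add: vertical_def fun_eq_iff scaleR_add_right mult.commute)
    hence "F (?c t) (vertical (?c t) a) = F (?c t) (vertical c a) + t * F (?c t) ?w"
      using linear_form_add[OF F(2) that v C_inf_scaleR[OF w]] linear_form_scaleR[OF F(2) that w] by simp
    thus ?thesis using horizontal[OF that a] by simp
  qed
  hence ev: "\<forall>\<^sub>F t in nhds 0. F (?c t) (vertical c a) = - (t * F (?c t) ?w)"
    by (rule eventually_mono[OF eventually_Imm[OF c k]])
  have "((\<lambda>t. - (t * F (?c t) ?w)) has_real_derivative - (F c ?w)) (at 0)"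
    using DERIV_minus[OF DERIV_mult[OF DERIV_ident dir_deriv_works[OF F(1) c k w]]] by simp
  thus "((\<lambda>t. F (?c t) (vertical c a)) has_real_derivative - F c ?w) (at 0)"
    by (subst DERIV_cong_ev[OF refl ev refl])
qed

text \<open>On the surface E f (s, t) = f + s (displacement at time t), applied to \<open>c\<close>
  and \<open>k\<close> alike, the diagonal is reparametrisation by id + t a, where \<open>F\<close>
  is constant by invariance. The axis s = 0 is constant too. On the axis t = 0 the point moves along
  a c_\<theta> and the vector along a k_\<theta>, which yields the two terms that must
  cancel.\<close>

lemma dir_deriv_vertical:
  assumes c: "c \<in> Imm" and a: "a \<in> C_inf" and k: "k \<in> C_inf"
  shows "dir_deriv (vertical c a) (\<lambda>c. F c k) c = - F c (vertical k a)"
proof -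
  let ?T = "topspace (Euclidean_space 2)" and ?v = "vertical c a" and ?w = "vertical k a"
  note cC = Imm_C_inf[OF c]
  have w: "?w \<in> C_inf" and v: "?v \<in> C_inf" using vertical_C_inf a k cC by blast+
  define E where "E = (\<lambda>f x \<theta>. f \<theta> + x 0 *\<^sub>R displacement a f (x (1::nat)) \<theta>)"
  have E: "smooth_family 2 ?T (E f)" if "f \<in> C_inf" for f unfolding E_def
    by (rule smooth_family_add[OF smooth_family_const[OF that openin_topspace]
          smooth_family_scaleR[OF smooth_on_Rn_coord[OF openin_topspace] smooth_family_displacement[OF that a]]])
  define V where "V = {x \<in> ?T. E c x \<in> Imm}"
  have fam: "Imm_family 2 V (E c)" unfolding V_def by (rule smooth_family_Imm_restrict[OF E[OF cC]])
  have V: "openin (Euclidean_space 2) V" using fam smooth_family_open unfolding Imm_family_def by blast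
  have VT: "V \<subseteq> ?T" by (auto simp: V_def)
  have A: "smooth_on_Rn 2 V (\<lambda>x. F (E c x) (E k x))"
    by (rule smooth_formD[OF F(1) fam smooth_family_subset[OF E[OF k] VT V]])
  have V0: "pt2 0 0 \<in> V" using c by (simp add: V_def pt2_mem E_def)
  have "F (E c (pt2 s 0)) (E k (pt2 s 0)) = F (\<lambda>\<theta>. c \<theta> + s *\<^sub>R ?v \<theta>) k + s * F (\<lambda>\<theta>. c \<theta> + s *\<^sub>R ?v \<theta>) ?w"
    if "(\<lambda>\<theta>. c \<theta> + s *\<^sub>R ?v \<theta>) \<in> Imm" for s
    using linear_form_add[OF F(2) that k C_inf_scaleR[OF w]] linear_form_scaleR[OF F(2) that w]
    by (simp add: E_def displacement_0)
  hence ev: "\<forall>\<^sub>F s in nhds 0. F (E c (pt2 s 0)) (E k (pt2 s 0)) =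
      F (\<lambda>\<theta>. c \<theta> + s *\<^sub>R ?v \<theta>) k + s * F (\<lambda>\<theta>. c \<theta> + s *\<^sub>R ?v \<theta>) ?w"
    by (rule eventually_mono[OF eventually_Imm[OF c v]])
  have "((\<lambda>s. F (\<lambda>\<theta>. c \<theta> + s *\<^sub>R ?v \<theta>) k + s * F (\<lambda>\<theta>. c \<theta> + s *\<^sub>R ?v \<theta>) ?w)
      has_real_derivative dir_deriv ?v (\<lambda>c. F c k) c + F c ?w) (at 0)"
    using DERIV_add[OF dir_deriv_works[OF F(1) c v k]
        DERIV_mult[OF DERIV_ident dir_deriv_works[OF F(1) c v w]]] by simp
  hence 1: "((\<lambda>s. F (E c (pt2 s 0)) (E k (pt2 s 0))) has_real_derivative
      dir_deriv ?v (\<lambda>c. F c k) c + F c ?w) (at 0)"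
    by (subst DERIV_cong_ev[OF refl ev refl])
  have 2: "((\<lambda>t. F (E c (pt2 0 t)) (E k (pt2 0 t))) has_real_derivative 0) (at 0)"
    by (simp add: E_def)
  have "F (E c (pt2 t t)) (E k (pt2 t t)) = F c k" if "(\<lambda>\<theta>. \<theta> + t * a \<theta>) \<in> Diff_plus" for t
  proof -
    have "E f (pt2 t t) = f \<circ> (\<lambda>\<theta>. \<theta> + t * a \<theta>)" if "f \<in> C_inf" for f
      using displacement_eq[OF that] by (simp add: E_def o_def)
    thus ?thesis using invariant[OF that c k] cC k by simp
  qed
  hence ev: "\<forall>\<^sub>F t in nhds 0. F (E c (pt2 t t)) (E k (pt2 t t)) = F c k"
    by (rule eventually_mono[OF eventually_Diff_plus[OF a]])
  have 3: "((\<lambda>t. F (E c (pt2 t t)) (E k (pt2 t t))) has_real_derivative 0) (at 0)"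
    by (subst DERIV_cong_ev[OF refl ev refl]) simp
  from DERIV_unique[OF diagonal_derivative[OF A V0 1 2] 3] show ?thesis by simp
qed

lemma d_one_form_vertical:
  assumes "c \<in> Imm" "a \<in> C_inf" "k \<in> C_inf"
  shows "d_one_form F c (vertical c a) k = 0"
  using dir_deriv_vertical[OF assms] dir_deriv_on_vertical[OF assms] by (simp add: d_one_form_def)

end

text \<open>The value on a class of tangent pairs is read off any representative: two
  representatives differ by a common \<phi>, removed by invariance, and by vertical vectors, removed
  slot by slot.\<close>

lemma factors_to_B_i:
  assumes \<alpha>: "two_form \<alpha>" "closed_two_form \<alpha>"
    and invariant: "\<And>\<phi> c h k. \<phi> \<in> Diff_plus \<Longrightarrow> c \<in> Imm \<Longrightarrow> h \<in> C_inf \<Longrightarrow> k \<in> C_inf \<Longrightarrow>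
      \<alpha> (c \<circ> \<phi>) (h \<circ> \<phi>) (k \<circ> \<phi>) = \<alpha> c h k"
    and horizontal: "\<And>c a k. c \<in> Imm \<Longrightarrow> a \<in> C_inf \<Longrightarrow> k \<in> C_inf \<Longrightarrow> \<alpha> c (vertical c a) k = 0"
  shows "\<exists>\<beta>. presymplectic_B_i \<beta> \<and> factors_to \<alpha> \<beta>"
proof -
  have lin: "linear_on_C_inf (\<alpha> c h)" "linear_on_C_inf (\<lambda>k. \<alpha> c k h)" if "c \<in> Imm" "h \<in> C_inf" for c h
    using \<alpha>(1) that unfolding two_form_def bilinear_field_def by blast+
  have add: "\<alpha> c (\<lambda>\<theta>. h \<theta> + k \<theta>) l = \<alpha> c h l + \<alpha> c k l" "\<alpha> c l (\<lambda>\<theta>. h \<theta> + k \<theta>) = \<alpha> c l h + \<alpha> c l k"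
    if "c \<in> Imm" "h \<in> C_inf" "k \<in> C_inf" "l \<in> C_inf" for c h k l
    using lin[OF that(1,4)] that unfolding linear_on_C_inf_def by blast+
  have alt: "\<alpha> c h h = 0" if "c \<in> Imm" "h \<in> C_inf" for c h
    using \<alpha>(1) that unfolding two_form_def by blast
  \<comment> \<open>Polarisation: the form vanishes on h + k inserted twice. This transfers
    horizontality to the second slot.\<close>
  have skew: "\<alpha> c h k = - \<alpha> c k h" if "c \<in> Imm" "h \<in> C_inf" "k \<in> C_inf" for c h k
    using alt[OF that(1) C_inf_add[OF that(2,3)]] add[OF that(1,2,3)] C_inf_add[OF that(2,3)]
      alt[OF that(1,2)] alt[OF that(1,3)] that by simp
  have transport: "\<alpha> c' h' k' = \<alpha> c h k"
    if asm: "c \<in> Imm" "h \<in> C_inf" "k \<in> C_inf" "(c', h', k') \<in> tangent_pair c h k" for c h k c' h' k'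
  proof -
    obtain \<phi> a b where ab: "\<phi> \<in> Diff_plus" "a \<in> C_inf" "b \<in> C_inf" and c': "c' = c \<circ> \<phi>"
      and h': "h' = (\<lambda>\<theta>. (h \<circ> \<phi>) \<theta> + vertical c' a \<theta>)" and k': "k' = (\<lambda>\<theta>. (k \<circ> \<phi>) \<theta> + vertical c' b \<theta>)"
      using asm(4) unfolding tangent_pair_def by blast
    have I: "c' \<in> Imm" unfolding c' by (rule Imm_comp_Diff[OF asm(1) ab(1)])
    have hC: "h \<circ> \<phi> \<in> C_inf" and kC: "k \<circ> \<phi> \<in> C_inf" using C_inf_comp_Diff asm(2,3) ab(1) by blast+
    have va: "vertical c' a \<in> C_inf" and vb: "vertical c' b \<in> C_inf"
      using vertical_C_inf[OF Imm_C_inf[OF I]] ab by blast+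
    have k'C: "k' \<in> C_inf" unfolding k' by (rule C_inf_add[OF kC vb])
    have "\<alpha> c' h' k' = \<alpha> c' (h \<circ> \<phi>) k'"
      unfolding h' add(1)[OF I hC va k'C] horizontal[OF I ab(2) k'C] by simp
    also have "\<dots> = \<alpha> c' (h \<circ> \<phi>) (k \<circ> \<phi>)"
      unfolding k' add(2)[OF I kC vb hC] skew[OF I hC vb] horizontal[OF I ab(3) hC] by simp
    also have "\<dots> = \<alpha> c h k" unfolding c' by (rule invariant[OF ab(1) asm(1-3)])
    finally show ?thesis .
  qed
  \<comment> \<open>The identity arises as id + 0 a with a = 0; the vertical corrections are zero as
    well.\<close>
  have refl: "(c, h, k) \<in> tangent_pair c h k" if "c \<in> Imm" for c h k
  proof -
    have "(\<lambda>\<theta>. \<theta> + 0 * (0::real)) \<in> Diff_plus"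
      using eventually_nhds_x_imp_x[OF eventually_Diff_plus[OF C_inf_const[of "0::real"]]] by simp
    hence "(\<lambda>\<theta>. \<theta>) \<in> Diff_plus" by simp
    moreover have "(\<lambda>_. 0::real) \<in> C_inf" by (rule C_inf_const)
    ultimately show ?thesis unfolding tangent_pair_def vertical_def
      by (intro CollectI exI[of _ "\<lambda>\<theta>. \<theta>"] exI[of _ "\<lambda>_. 0"]) (simp add: o_def)
  qed
  \<comment> \<open>The choice operator picks the value at some representative; outside the tangent
    pairs the value is \<open>undefined\<close>, as \<open>presymplectic_B_i\<close>
    demands.\<close>
  define \<beta> :: shape_tensor where "\<beta> = (\<lambda>p X. if p \<in> B_i \<and> X \<in> tangent_pairs p then
      SOME r. \<exists>c h k. c \<in> Imm \<and> h \<in> C_inf \<and> k \<in> C_inf \<and> X = tangent_pair c h k \<and> r = \<alpha> c h k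
    else undefined)"
  have pb: "pullback \<beta> c h k = \<alpha> c h k" if asm: "c \<in> Imm" "h \<in> C_inf" "k \<in> C_inf" for c h k
  proof -
    let ?P = "\<lambda>r. \<exists>c' h' k'. c' \<in> Imm \<and> h' \<in> C_inf \<and> k' \<in> C_inf \<and>
      tangent_pair c h k = tangent_pair c' h' k' \<and> r = \<alpha> c' h' k'"
    have "proj c \<in> B_i" "tangent_pair c h k \<in> tangent_pairs (proj c)"
      using asm unfolding B_i_def tangent_pairs_def by blast+
    hence "pullback \<beta> c h k = (SOME r. ?P r)" by (simp add: pullback_def \<beta>_def)
    also have "\<dots> = \<alpha> c h k"
    proof (rule some_equality)
      show "?P (\<alpha> c h k)" using asm by blast
      fix r assume "?P r"
      then obtain c' h' k' where *: "c' \<in> Imm" "h' \<in> C_inf" "k' \<in> C_inf"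
        "tangent_pair c h k = tangent_pair c' h' k'" "r = \<alpha> c' h' k'" by blast
      \<comment> \<open>Equal classes share the member (c', h', k'), so \<open>transport\<close>
        compares the two representatives directly.\<close>
      have "(c', h', k') \<in> tangent_pair c h k" unfolding *(4) by (rule refl[OF *(1)])
      from transport[OF asm this] show "r = \<alpha> c h k" using *(5) by simp
    qed
    finally show ?thesis .
  qed
  have "two_form (pullback \<beta>)"
    unfolding two_form_def bilinear_field_def
  proof (intro conjI ballI allI impI)
    fix c h :: curve assume ch: "c \<in> Imm" "h \<in> C_inf"
    show "linear_on_C_inf (pullback \<beta> c h)" "linear_on_C_inf (\<lambda>k. pullback \<beta> c k h)"
      using lin[OF ch] ch unfolding linear_on_C_inf_def by (simp_all add: pb C_inf_add C_inf_scaleR)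
    show "pullback \<beta> c h h = 0" using alt[OF ch] pb ch by simp
  next
    fix n U c and h k :: "(nat \<Rightarrow> real) \<Rightarrow> curve"
  assume fam: "Imm_family n U c" "smooth_family n U h" "smooth_family n U k"
    have "smooth_on_Rn n U (\<lambda>x. \<alpha> (c x) (h x) (k x))"
      using \<alpha>(1) fam unfolding two_form_def bilinear_field_def by blast
    thus "smooth_on_Rn n U (\<lambda>x. pullback \<beta> (c x) (h x) (k x))"
    proof (rule smooth_on_Rn_cong)
      fix x assume x: "x \<in> U"
      have "c x \<in> Imm" using fam(1) x unfolding Imm_family_def by blast
      from pb[OF this smooth_family_C_inf[OF fam(2) x] smooth_family_C_inf[OF fam(3) x]]
      show "\<alpha> (c x) (h x) (k x) = pullback \<beta> (c x) (h x) (k x)" by simp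
    qed
  qed
  moreover have "closed_two_form (pullback \<beta>)"
    unfolding closed_two_form_def
  proof (intro ballI)
    fix c h k l :: curve assume c: "c \<in> Imm" and hkl: "h \<in> C_inf" "k \<in> C_inf" "l \<in> C_inf"
    \<comment> \<open>The pullback is known to equal \<alpha> only at immersions, which is all that
      a directional derivative at an immersion depends on.\<close>
    have "dir_deriv h (\<lambda>c. pullback \<beta> c k l) c = dir_deriv h (\<lambda>c. \<alpha> c k l) c"
      if "h \<in> C_inf" "k \<in> C_inf" "l \<in> C_inf" for h k l
      by (rule dir_deriv_cong[OF c that(1)]) (rule pb[OF _ that(2,3)])
    hence "d_two_form (pullback \<beta>) c h k l = d_two_form \<alpha> c h k l"
      unfolding d_two_form_def using hkl by simp
    thus "d_two_form (pullback \<beta>) c h k l = 0" using \<alpha>(2) c hkl unfolding closed_two_form_def by simp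
  qed
  moreover have "\<beta> p X = undefined" if "\<not> (p \<in> B_i \<and> X \<in> tangent_pairs p)" for p X
    using that unfolding \<beta>_def by (simp only: if_False)
  ultimately have "presymplectic_B_i \<beta>" unfolding presymplectic_B_i_def by blast
  moreover have "factors_to \<alpha> \<beta>" unfolding factors_to_def using pb by simp
  ultimately show ?thesis by blast
qed

section \<open>The one-form of an inertia operator\<close>

lemma bounded_bilinear_cross3: "bounded_bilinear cross3"
  using bilinear_cross bilinear_conv_bounded_bilinear by blast

definition Theta_density :: "(curve \<Rightarrow> curve \<Rightarrow> curve) \<Rightarrow> curve \<Rightarrow> curve \<Rightarrow> real \<Rightarrow> real"
  where "Theta_density L c h = (\<lambda>\<theta>. cross3 (c \<theta>) (D\<theta> c \<theta>) \<bullet> L c h \<theta>)"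

lemma Theta_eq:
  assumes "c \<in> Imm"
  shows "Theta L c h = integral {0..2*pi} (Theta_density L c h)"
proof -
  have "cross3 (c \<theta>) (Ds c c \<theta>) \<bullet> L c h \<theta> * norm (D\<theta> c \<theta>) = Theta_density L c h \<theta>" for \<theta>
    using assms by (simp add: Imm_def Ds_def cross_mult_right Theta_density_def)
  thus ?thesis by (simp add: Theta_def integral_ds_def)
qed

text \<open>The density is assembled from \<open>D\<theta>\<close>, the field \<open>L\<close> and
  two bilinear products, each of which preserves smooth families.\<close>

lemma smooth_family_Theta_density:
  assumes L: "smooth_operator_field L" and c: "Imm_family n U c" and h: "smooth_family n U h"
  shows "smooth_family n U (\<lambda>x. Theta_density L (c x) (h x))"
proof -
  have c': "smooth_family n U c" using c unfolding Imm_family_def by blast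
  have Lf: "smooth_family n U (\<lambda>x. L (c x) (h x))"
    using L c h unfolding smooth_operator_field_def by blast
  show ?thesis unfolding Theta_density_def
    by (rule smooth_family_bilinear[OF bounded_bilinear_inner
          smooth_family_bilinear[OF bounded_bilinear_cross3 c' smooth_family_D\<theta>[OF c']] Lf])
qed

lemma Theta_density_C_inf:
  assumes L: "smooth_operator_field L" and c: "c \<in> Imm" and h: "h \<in> C_inf"
  shows "Theta_density L c h \<in> C_inf"
  unfolding C_inf_iff_smooth_family
  by (rule smooth_family_Theta_density[OF L Imm_family_const[OF c openin_Euclidean_space_0]
        smooth_family_const[OF h openin_Euclidean_space_0]])

lemma smooth_form_Theta:
  assumes L: "smooth_operator_field L"
  shows "smooth_form (Theta L)"
  unfolding smooth_form_def
proof (intro allI impI)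
  fix n U c and h :: "(nat \<Rightarrow> real) \<Rightarrow> curve"
  assume fam: "Imm_family n U c" "smooth_family n U h"
  show "smooth_on_Rn n U (\<lambda>x. Theta L (c x) (h x))"
    by (rule smooth_on_Rn_cong[OF smooth_family_integral[OF smooth_family_Theta_density[OF L fam]] Theta_eq[symmetric]])
      (use fam(1) in \<open>auto simp: Imm_family_def\<close>)
qed

lemma linear_form_Theta:
  assumes L: "smooth_operator_field L"
  shows "linear_form (Theta L)"
  unfolding linear_form_def linear_on_C_inf_def
proof (intro ballI conjI allI)
  fix c h k :: curve assume c: "c \<in> Imm" and h: "h \<in> C_inf" and k: "k \<in> C_inf"
  have int: "Theta_density L c f integrable_on {0..2*pi}" if "f \<in> C_inf" for f
    by (intro integrable_continuous_interval C_inf_continuous Theta_density_C_inf L c that)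
  have "L c (\<lambda>\<theta>. h \<theta> + k \<theta>) = (\<lambda>\<theta>. L c h \<theta> + L c k \<theta>)"
    using L c h k unfolding smooth_operator_field_def by blast
  hence "Theta_density L c (\<lambda>\<theta>. h \<theta> + k \<theta>) = (\<lambda>\<theta>. Theta_density L c h \<theta> + Theta_density L c k \<theta>)"
    by (simp add: Theta_density_def inner_add_right)
  thus "Theta L c (\<lambda>\<theta>. h \<theta> + k \<theta>) = Theta L c h + Theta L c k"
    using integral_add[OF int[OF h] int[OF k]] by (simp add: Theta_eq[OF c])
next
  fix c h :: curve and r assume c: "c \<in> Imm" and h: "h \<in> C_inf"
  have "L c (\<lambda>\<theta>. r *\<^sub>R h \<theta>) = (\<lambda>\<theta>. r *\<^sub>R L c h \<theta>)"
    using L c h unfolding smooth_operator_field_def by blast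
  hence "Theta_density L c (\<lambda>\<theta>. r *\<^sub>R h \<theta>) = (\<lambda>\<theta>. r * Theta_density L c h \<theta>)"
    by (simp add: Theta_density_def)
  thus "Theta L c (\<lambda>\<theta>. r *\<^sub>R h \<theta>) = r * Theta L c h" by (simp add: Theta_eq[OF c])
qed

text \<open>Exactly one derivative of the curve occurs in the density, so the chain rule produces
  exactly one factor \<open>D\<theta> \<phi>\<close>, the Jacobian of the substitution.\<close>

lemma Theta_invariant:
  assumes L: "smooth_operator_field L" "Diff_equivariant L"
    and \<phi>: "\<phi> \<in> Diff_plus" and c: "c \<in> Imm" and h: "h \<in> C_inf"
  shows "Theta L (c \<circ> \<phi>) (h \<circ> \<phi>) = Theta L c h"
proof -
  have "L (c \<circ> \<phi>) (h \<circ> \<phi>) = L c h \<circ> \<phi>" using L(2) \<phi> c h unfolding Diff_equivariant_def by blast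
  hence "Theta_density L (c \<circ> \<phi>) (h \<circ> \<phi>) = (\<lambda>\<theta>. D\<theta> \<phi> \<theta> * Theta_density L c h (\<phi> \<theta>))"
    by (simp add: Theta_density_def D\<theta>_comp_Diff[OF Imm_C_inf[OF c] \<phi>] cross_mult_right fun_eq_iff)
  thus ?thesis
    using integral_Diff_plus[OF Theta_density_C_inf[OF L(1) c h] \<phi>]
    by (simp add: Theta_eq c Imm_comp_Diff[OF c \<phi>])
qed

theorem theorem2p6:
  fixes L :: "curve \<Rightarrow> curve \<Rightarrow> curve"
  assumes "inertia_operator L"
    and "Diff_equivariant L"
    and "\<forall>c\<in>Imm. \<forall>a\<in>C_inf. \<exists>a1\<in>C_inf. \<exists>a2\<in>C_inf.
           L c (vertical c a) = (\<lambda>\<theta>. a1 \<theta> *\<^sub>R D\<theta> c \<theta> + a2 \<theta> *\<^sub>R c \<theta>)"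
  shows "\<exists>\<beta>. presymplectic_B_i \<beta> \<and> factors_to (Omega L) \<beta>"
proof (rule factors_to_B_i)
  have L: "smooth_operator_field L" using assms(1) unfolding inertia_operator_def by blast
  note F = smooth_form_Theta[OF L] linear_form_Theta[OF L]
  note inv = Theta_invariant[OF L assms(2)]
  have hor: "Theta L c (vertical c a) = 0" if "c \<in> Imm" "a \<in> C_inf" for c a
  proof -
    obtain a1 a2 where "L c (vertical c a) = (\<lambda>\<theta>. a1 \<theta> *\<^sub>R D\<theta> c \<theta> + a2 \<theta> *\<^sub>R c \<theta>)"
      using assms(3) \<open>c \<in> Imm\<close> \<open>a \<in> C_inf\<close> by blast
    hence "Theta_density L c (vertical c a) = (\<lambda>_. 0)"
      by (simp add: Theta_density_def inner_add_right dot_cross_self fun_eq_iff)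
    thus ?thesis by (simp add: Theta_eq[OF that(1)])
  qed
  have Omega: "Omega L = (\<lambda>c h k. - d_one_form (Theta L) c h k)"
    by (simp add: Omega_def fun_eq_iff)
  show "two_form (Omega L)" unfolding Omega by (rule two_form_d_one_form[OF F])
  show "closed_two_form (Omega L)" unfolding Omega by (rule closed_d_one_form[OF F(1)])
  show "Omega L (c \<circ> \<phi>) (h \<circ> \<phi>) (k \<circ> \<phi>) = Omega L c h k"
    if "\<phi> \<in> Diff_plus" "c \<in> Imm" "h \<in> C_inf" "k \<in> C_inf" for \<phi> c h k
    unfolding Omega_def d_one_form_def
    by (simp only: dir_deriv_invariant[of "Theta L", OF inv that(1,2,3,4)]
        dir_deriv_invariant[of "Theta L", OF inv that(1,2,4,3)])
  show "Omega L c (vertical c a) k = 0" if "c \<in> Imm" "a \<in> C_inf" "k \<in> C_inf" for c a k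
    unfolding Omega_def by (simp add: d_one_form_vertical[OF F inv hor that])
qed

end
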